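(* Let $(M,d)$ be a Polish length space, let $p\ge1$ and $C>0$, and let $P$ be a Markov transition kernel on $(M,d)$ such that: 1. $P_x\in\mathrm{Pr}_{d,p}(M)$ for all $x\in M$; 2. the map $x\mapsto P_x$ from $(M,d)$ to $(\mathrm{Pr}_{d,p}(M),W_{d,p})$ is locally $C$-Lipschitz. Then for all $\mu\in\mathrm{Pr}_{d,p}(M)$ we have $\mu P\in\mathrm{Pr}_{d,p}(M)$, and the map $\mu\mapsto\mu P$ is $C$-Lipschitz, that is, $$\forall\mu,\nu\in\mathrm{Pr}_{d,p}(M),\qquad W_{d,p}(\mu P,\nu P)\le C\,W_{d,p}(\mu,\nu).$$
   Context: Polish means complete and separable (as a metric space). For a continuous curve $\gamma:[a,b]\to M$, its length is $L_d(\gamma)=\sup\sum_{i=1}^m d(\gamma(t_{i-1}),\gamma(t_i))$ over all $m\in\mathbb{N}$ and $a=t_0\le t_1\le\cdots\le t_m=b$. $(M,d)$ is a length space if for all $x,y\in M$, $d(x,y)=\inf\{L_d(\gamma):\gamma:[0,1]\to M\text{ continuous},\gamma(0)=x,\gamma(1)=y\}$. $\mathrm{Pr}_{d,p}(M)$ is the set of Borel probability measures $\mu$ on $M$ with $\int d(o,x)^p\,d\mu(x)<\infty$ for some (equivalently every) $o\in M$. For $\mu,\nu\in\mathrm{Pr}_{d,p}(M)$, $W_{d,p}(\mu,\nu)=\inf\left(\int d(x,y)^p\,d\eta(x,y)\right)^{1/p}$, the infimum over all couplings $\eta$ of $\mu$ and $\nu$ (probability measures on $M\times M$ with marginals $\mu,\nu$).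 A Markov transition kernel on $M$ is a map $P:M\times\mathcal{B}(M)\to[0,1]$ (with $\mathcal{B}(M)$ the Borel $\sigma$-field) such that $P_x(\cdot)=P(x,\cdot)$ is a probability measure for each $x$ and $x\mapsto P_x(A)$ is measurable for each $A\in\mathcal{B}(M)$; $\mu P(A)=\int P_x(A)\,d\mu(x)$. A map $f:M\to N$ between metric spaces $(M,d)$ and $(N,d')$ is locally $C$-Lipschitz if for all $x\in M$, $\limsup_{y\to x}\frac{d'(f(x),f(y))}{d(x,y)}\le C$ (the limsup over $y\ne x$). *)

theory Defs
  imports "HOL-Probability.Probability"
begin

definition curve_length :: "real \<Rightarrow> real \<Rightarrow> (real \<Rightarrow> 'a::metric_space) \<Rightarrow> ennreal" where
  "curve_length a b \<gamma> =
     (SUP (m, t) \<in> {(m::nat, t::nat \<Rightarrow> real). t 0 = a \<and> t m = b \<and> mono_on {..m} t}.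
        \<Sum>i=1..m. ennreal (dist (\<gamma> (t (i - 1))) (\<gamma> (t i))))"

class length_space = metric_space +
  assumes dist_eq_INF_curve_length:
    "ennreal (dist x y) =
       (INF \<gamma> \<in> {\<gamma>. path \<gamma> \<and> pathstart \<gamma> = x \<and> pathfinish \<gamma> = y}. curve_length 0 1 \<gamma>)"

text \<open>Nonnegative extended-real power for a positive exponent, so that infinity is sent to
  infinity and 0 to 0.\<close>

definition epowr :: "ennreal \<Rightarrow> real \<Rightarrow> ennreal" where
  "epowr x a = (if x = \<infinity> then \<infinity> else ennreal (enn2real x powr a))"

definition Pr :: "real \<Rightarrow> 'a::polish_space measure set" where
  "Pr p = {\<mu>. prob_space \<mu> \<and> sets \<mu> = sets borel \<and>
              (\<exists>z. (\<integral>\<^sup>+x. ennreal (dist z x powr p) \<partial>\<mu>) < \<infinity>)}"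

definition couplings :: "'a measure \<Rightarrow> 'b measure \<Rightarrow> ('a \<times> 'b) measure set" where
  "couplings \<mu> \<nu> = {\<eta>. prob_space \<eta> \<and> sets \<eta> = sets (\<mu> \<Otimes>\<^sub>M \<nu>) \<and>
                       distr \<eta> \<mu> fst = \<mu> \<and> distr \<eta> \<nu> snd = \<nu>}"

definition Wass :: "real \<Rightarrow> 'a::polish_space measure \<Rightarrow> 'a measure \<Rightarrow> ennreal" where
  "Wass p \<mu> \<nu> =
     (INF \<eta> \<in> couplings \<mu> \<nu>. epowr (\<integral>\<^sup>+(x, y). ennreal (dist x y powr p) \<partial>\<eta>) (1 / p))"

text \<open>The target metric \<open>D\<close> is passed explicitly and takes extended values, as \<open>Wass p\<close> does
  outside \<open>Pr p\<close>. At an isolated point the filter \<open>at x\<close> is trivial and the condition is void.\<close>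

definition locally_lipschitz ::
    "real \<Rightarrow> ('b \<Rightarrow> 'b \<Rightarrow> ennreal) \<Rightarrow> ('a::metric_space \<Rightarrow> 'b) \<Rightarrow> bool" where
  "locally_lipschitz C D f \<longleftrightarrow>
     (\<forall>x. Limsup (at x) (\<lambda>y. D (f x) (f y) / ennreal (dist x y)) \<le> ennreal C)"

text \<open>Markov kernels are measurable maps into \<open>prob_algebra borel\<close>, and \<open>\<mu>P\<close> is the Giry bind.
  The next two facts identify them with the usual pointwise descriptions.\<close>

lemma markov_kernel_iff:
  fixes P :: "'a::topological_space \<Rightarrow> 'a measure"
  shows "P \<in> borel \<rightarrow>\<^sub>M prob_algebra borel \<longleftrightarrow>
     (\<forall>x. prob_space (P x) \<and> sets (P x) = sets borel) \<and>
     (\<forall>A\<in>sets borel. (\<lambda>x. measure (P x) A) \<in> borel_measurable borel)"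
    (is "?L \<longleftrightarrow> ?R")
proof
  assume L: ?L
  then have "P x \<in> space (prob_algebra borel)" for x
    by (auto dest: measurable_space)
  moreover have "(\<lambda>x. measure (P x) A) \<in> borel_measurable borel" if "A \<in> sets borel" for A
    using measurable_prob_algebraD[OF L] that by measurable
  ultimately show ?R by (auto simp: space_prob_algebra)
next
  assume R: ?R
  show ?L
  proof (rule measurable_prob_algebraI)
    show "prob_space (P x)" for x using R by auto
    show "P \<in> borel \<rightarrow>\<^sub>M subprob_algebra borel"
    proof (rule measurable_subprob_algebra)
      fix A :: "'a set" assume A: "A \<in> sets borel"
      have "(\<lambda>x. emeasure (P x) A) = (\<lambda>x. ennreal (measure (P x) A))"
        using R by (auto simp: fun_eq_iff finite_measure.emeasure_eq_measure
            prob_space.finite_measure)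
      then show "(\<lambda>x. emeasure (P x) A) \<in> borel_measurable borel"
        using R A by auto
    qed (use R in \<open>auto intro: prob_space_imp_subprob_space\<close>)
  qed
qed

lemma emeasure_kernel_action:
  fixes P :: "'a::topological_space \<Rightarrow> 'a measure"
  assumes P: "P \<in> borel \<rightarrow>\<^sub>M prob_algebra borel" and \<mu>: "sets \<mu> = sets borel"
    and A: "A \<in> sets borel"
  shows "emeasure (\<mu> \<bind> P) A = (\<integral>\<^sup>+x. emeasure (P x) A \<partial>\<mu>)"
proof (rule emeasure_bind[OF _ _ A])
  show "P \<in> \<mu> \<rightarrow>\<^sub>M subprob_algebra borel"
    using measurable_prob_algebraD[OF P] \<mu> by (simp cong: measurable_cong_sets)
  show "space \<mu> \<noteq> {}" using sets_eq_imp_space_eq[OF \<mu>] by simp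
qed

end

theory Submission
  imports Defs
begin

text \<open>
  Couplings are glued along a countable partition of the middle space into small cells, which gives
  the triangle inequality for \<open>Wass\<close> without disintegration. Along a nearly shortest curve the local
  Lipschitz bounds then add up to \<open>Wass p (P x) (P y) \<le> C * dist x y\<close>. To lift this to mixtures
  without selecting couplings measurably, partition the space into countably many pieces on which
  \<open>x \<mapsto> P x\<close> is \<open>\<epsilon>\<close>-constant; the pieces are preimages of sets of measures defined by affine
  inequalities, so the average of \<open>P\<close> over a piece is as close to its members as they are to each
  other. A coupling of \<open>\<mu>\<close> and \<open>\<nu>\<close> then mixes countably many nearly optimal couplings of averages,
  at cost \<open>(C * dist x y + O(\<epsilon>)) powr p\<close> per pair, and Minkowski's inequality concludes.
\<close>

subsection \<open>Minkowski's inequality\<close>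

text \<open>Wasserstein balls would be the obvious pieces, but that an average of \<open>P\<close>
  over a ball stays near the centre is convexity of the distance under continuous mixtures, which
  again asks for a measurable choice of couplings. Lower bounds on cell masses and one upper bound
  on a moment survive integration for trivial reasons. They must also force closeness: the
  guaranteed masses go to fixed centres and the surplus to a base point, and the surplus is cheap
  because the guaranteed masses already account for the moment up to a fixed tolerance. As masses
  are bounded from below only, weights can be rounded down to finite lists of rationals, so
  countably many classes suffice. Couplings are then chosen for pairs of averages only, a countable
  family on which measurability is automatic. These couplings are only nearly optimal, so each
  approximation costs an epsilon, removed at the very end.\<close>

lemma powr_convex_nonneg:
  fixes x y t p :: real
  assumes p: "p \<ge> 1" and "0 \<le> x" "0 \<le> y" "0 \<le> t" "t \<le> 1"
  shows "(t * x + (1 - t) * y) powr p \<le> t * x powr p + (1 - t) * y powr p"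
proof -
  \<comment> \<open>If one argument vanishes, convexity reduces to \<open>s powr p \<le> s\<close>
    on [0,1]; two positive arguments are the ordinary convexity of the power.\<close>
  have shrink: "(s * z) powr p \<le> s * z powr p" if "0 \<le> s" "s \<le> 1" "0 \<le> z" for s z :: real
  proof (cases "s = 0")
    case False
    then have "s powr p \<le> s powr 1"
      using that p powr_mono_both'[of 1 p s s] by auto
    then show ?thesis
      using that by (simp add: powr_mult mult_right_mono)
  qed auto
  consider "x = 0" | "y = 0" | "x > 0" "y > 0" using assms by linarith
  then show ?thesis
  proof cases
    case 1
    then show ?thesis using shrink[of "1 - t" y] assms by simp
  next
    case 2
    then show ?thesis using shrink[of t x] assms by simp
  next
    case 3
    then show ?thesis
      using convex_onD[OF powr_convex[OF p], of "1 - t" y x] assms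
      using convex_onD[OF powr_convex[OF p], of "1 - t" x y] assms
      by (simp add: algebra_simps)
  qed
qed

text \<open>With \<open>t = a / (a + b)\<close>, the function (f + g)/(a + b) is a convex
  combination of the normalised functions f/a and g/b, so convexity of the power can be integrated.
  Stating all bounds as p-th powers of positive reals keeps roots of extended integrals out of the
  later estimates.\<close>

lemma nn_integral_Minkowski:
  fixes f g :: "'a \<Rightarrow> real"
  assumes p: "p \<ge> 1" and [measurable]: "f \<in> borel_measurable M" "g \<in> borel_measurable M"
    and nonneg: "\<And>x. 0 \<le> f x" "\<And>x. 0 \<le> g x" and ab: "0 < a" "0 < b"
    and f: "(\<integral>\<^sup>+x. ennreal (f x powr p) \<partial>M) \<le> ennreal (a powr p)"
    and g: "(\<integral>\<^sup>+x. ennreal (g x powr p) \<partial>M) \<le> ennreal (b powr p)"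
  shows "(\<integral>\<^sup>+x. ennreal ((f x + g x) powr p) \<partial>M) \<le> ennreal ((a + b) powr p)"
proof -
  define t where "t = a / (a + b)"
  define u where "u = (a + b) powr p * t / a powr p"
  define v where "v = (a + b) powr p * (1 - t) / b powr p"
  have t: "0 \<le> t" "t \<le> 1" using ab by (auto simp: t_def)
  have uv: "0 \<le> u" "0 \<le> v" using t by (auto simp: u_def v_def)
  have *: "(f x + g x) powr p \<le> u * f x powr p + v * g x powr p" for x
  proof -
    have 1: "t * (f x / a) + (1 - t) * (g x / b) = (f x + g x) / (a + b)"
      using ab unfolding t_def by (simp add: divide_simps)
    have "((f x + g x) / (a + b)) powr p
        \<le> t * (f x / a) powr p + (1 - t) * (g x / b) powr p"
      using powr_convex_nonneg[OF p, of "f x / a" "g x / b" t] nonneg ab t unfolding 1 by auto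
    then have "(a + b) powr p * ((f x + g x) / (a + b)) powr p
        \<le> (a + b) powr p * (t * (f x / a) powr p + (1 - t) * (g x / b) powr p)"
      by (intro mult_left_mono) auto
    moreover have "(a + b) powr p * ((f x + g x) / (a + b)) powr p = (f x + g x) powr p"
      using ab nonneg[of x] by (simp add: powr_divide)
    ultimately show ?thesis
      using ab nonneg[of x] by (simp add: u_def v_def powr_divide algebra_simps)
  qed
  have "(\<integral>\<^sup>+x. ennreal ((f x + g x) powr p) \<partial>M)
      \<le> (\<integral>\<^sup>+x. ennreal u * ennreal (f x powr p) + ennreal v * ennreal (g x powr p) \<partial>M)"
    using * uv by (intro nn_integral_mono) (auto simp flip: ennreal_mult ennreal_plus)
  also have "\<dots> = ennreal u * (\<integral>\<^sup>+x. ennreal (f x powr p) \<partial>M)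
      + ennreal v * (\<integral>\<^sup>+x. ennreal (g x powr p) \<partial>M)"
    by (simp add: nn_integral_add nn_integral_cmult)
  also have "\<dots> \<le> ennreal u * ennreal (a powr p) + ennreal v * ennreal (b powr p)"
    by (intro add_mono mult_left_mono f g) auto
  also have "\<dots> = ennreal (u * a powr p + v * b powr p)"
    using uv by (auto simp flip: ennreal_mult ennreal_plus)
  also have "u * a powr p + v * b powr p = (a + b) powr p"
    using ab by (simp add: u_def v_def flip: distrib_left)
  finally show ?thesis .
qed

subsection \<open>Couplings and the Wasserstein distance\<close>

text \<open>A substitute for \<open>Wass\<close> without infimum and root:
  \<open>Wass p \<mu> \<nu> < ennreal r\<close> implies it for positive \<open>r\<close>, and it
  implies \<open>Wass p \<mu> \<nu> \<le> ennreal r\<close>. The gap between strict and weak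
  inequality is where the epsilons of the proof come from.\<close>

definition coupled_within ::
    "real \<Rightarrow> real \<Rightarrow> 'a::polish_space measure \<Rightarrow> 'a measure \<Rightarrow> bool" where
  "coupled_within p r \<mu> \<nu> \<longleftrightarrow>
     (\<exists>\<eta>\<in>couplings \<mu> \<nu>. (\<integral>\<^sup>+(x, y). ennreal (dist x y powr p) \<partial>\<eta>) \<le> ennreal (r powr p))"

lemma Wass_le_of_coupled_within:
  assumes "p \<ge> 1" "0 \<le> r" "coupled_within p r \<mu> \<nu>"
  shows "Wass p \<mu> \<nu> \<le> ennreal r"
proof -
  obtain \<eta> where \<eta>: "\<eta> \<in> couplings \<mu> \<nu>"
    and le: "(\<integral>\<^sup>+(x, y). ennreal (dist x y powr p) \<partial>\<eta>) \<le> ennreal (r powr p)"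
    using assms by (auto simp: coupled_within_def)
  define I where "I = (\<integral>\<^sup>+(x, y). ennreal (dist x y powr p) \<partial>\<eta>)"
  have fin: "I < \<infinity>" using le unfolding I_def by (rule order.strict_trans1) simp
  have "enn2real I \<le> r powr p" using le unfolding I_def[symmetric]
    by (simp add: enn2real_leI)
  then have "enn2real I powr (1 / p) \<le> (r powr p) powr (1 / p)"
    using assms by (intro powr_mono2) auto
  also have "\<dots> = r" using assms by (simp add: powr_powr)
  finally have "epowr I (1 / p) \<le> ennreal r"
    using fin by (auto simp: epowr_def intro: ennreal_leI)
  then show ?thesis unfolding Wass_def I_def using \<eta> by (rule INF_lower2[rotated])
qed

lemma coupled_within_of_Wass_less:
  assumes "p \<ge> 1" "0 < r" "Wass p \<mu> \<nu> < ennreal r"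
  shows "coupled_within p r \<mu> \<nu>"
proof -
  obtain \<eta> where \<eta>: "\<eta> \<in> couplings \<mu> \<nu>"
    and less: "epowr (\<integral>\<^sup>+(x, y). ennreal (dist x y powr p) \<partial>\<eta>) (1 / p) < ennreal r"
    using assms(3) unfolding Wass_def by (auto simp: INF_less_iff)
  define I where "I = (\<integral>\<^sup>+(x, y). ennreal (dist x y powr p) \<partial>\<eta>)"
  have fin: "I \<noteq> \<infinity>" using less unfolding I_def[symmetric] by (auto simp: epowr_def)
  have "enn2real I powr (1 / p) < r"
    using less fin unfolding I_def[symmetric] by (simp add: epowr_def ennreal_less_iff)
  then have "(enn2real I powr (1 / p)) powr p \<le> r powr p"
    using assms by (intro powr_mono2) auto
  then have "enn2real I \<le> r powr p" using assms by (simp add: powr_powr)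
  then have "I \<le> ennreal (r powr p)"
    using fin by (metis ennreal_enn2real ennreal_leI infinity_ennreal_def less_top)
  then show ?thesis using \<eta> by (auto simp: coupled_within_def I_def)
qed

lemma sets_pair_borel:
  fixes \<mu> :: "'a::second_countable_topology measure" and \<nu> :: "'b::second_countable_topology measure"
  assumes "sets \<mu> = sets borel" "sets \<nu> = sets borel"
  shows "sets (\<mu> \<Otimes>\<^sub>M \<nu>) = sets borel"
  using sets_pair_measure_cong[OF assms] by (simp only: borel_prod)

text \<open>Trading the sigma-algebras of the two marginals for \<open>borel\<close> turns couplings
  into points of \<open>prob_algebra borel\<close>, where they can be values of a kernel and be
  mixed by \<open>bind\<close>.\<close>

lemma couplings_iff:
  fixes \<mu> :: "'a::second_countable_topology measure" and \<nu> :: "'b::second_countable_topology measure"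
  assumes "sets \<mu> = sets borel" "sets \<nu> = sets borel"
  shows "\<eta> \<in> couplings \<mu> \<nu> \<longleftrightarrow> \<eta> \<in> space (prob_algebra borel) \<and>
           distr \<eta> borel fst = \<mu> \<and> distr \<eta> borel snd = \<nu>"
proof -
  have "distr \<eta> \<mu> fst = distr \<eta> borel fst" "distr \<eta> \<nu> snd = distr \<eta> borel snd"
    by (rule distr_cong; simp add: assms)+
  then show ?thesis
    unfolding couplings_def using sets_pair_borel[OF assms] by (auto simp: space_prob_algebra)
qed

text \<open>The probabilistic reading of a coupling as the joint law of two random variables; the
  auxiliary spaces for gluing and for randomised transport enter through it.\<close>

lemma coupled_within_distr:
  fixes X Y :: "'b \<Rightarrow> 'a::polish_space"
  assumes M: "prob_space M" and [measurable]: "X \<in> M \<rightarrow>\<^sub>M borel" "Y \<in> M \<rightarrow>\<^sub>M borel"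
    and "(\<integral>\<^sup>+\<omega>. ennreal (dist (X \<omega>) (Y \<omega>) powr p) \<partial>M) \<le> ennreal (r powr p)"
  shows "coupled_within p r (distr M borel X) (distr M borel Y)"
  unfolding coupled_within_def
proof (rule bexI)
  let ?H = "distr M borel (\<lambda>\<omega>. (X \<omega>, Y \<omega>))"
  have m: "(\<lambda>\<omega>. (X \<omega>, Y \<omega>)) \<in> M \<rightarrow>\<^sub>M borel" unfolding borel_prod[symmetric] by measurable
  show "?H \<in> couplings (distr M borel X) (distr M borel Y)"
    unfolding couplings_iff[OF sets_distr sets_distr]
  proof (intro conjI)
    show "?H \<in> space (prob_algebra borel)"
      using prob_space.prob_space_distr[OF M m] by (simp add: space_prob_algebra)
    show "distr ?H borel fst = distr M borel X" "distr ?H borel snd = distr M borel Y"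
      by (subst distr_distr; simp add: m borel_measurable_continuous_onI continuous_on_fst
          continuous_on_snd continuous_on_id o_def)+
  qed
  show "(\<integral>\<^sup>+(x, y). ennreal (dist x y powr p) \<partial>?H) \<le> ennreal (r powr p)"
    using assms(4) by (subst nn_integral_distr[OF m]) (simp_all add: split_beta flip: borel_prod)
qed

lemma coupled_withinE:
  fixes \<mu> \<nu> :: "'a::polish_space measure"
  assumes "coupled_within p r \<mu> \<nu>" and \<mu>: "sets \<mu> = sets borel" "sets \<nu> = sets borel"
  obtains \<eta> where "prob_space \<eta>" "sets \<eta> = sets (borel \<Otimes>\<^sub>M borel)"
    "distr \<eta> borel fst = \<mu>" "distr \<eta> borel snd = \<nu>"
    "(\<integral>\<^sup>+z. ennreal (dist (fst z) (snd z) powr p) \<partial>\<eta>) \<le> ennreal (r powr p)"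
proof -
  obtain \<eta> where "\<eta> \<in> couplings \<mu> \<nu>"
    "(\<integral>\<^sup>+(x, y). ennreal (dist x y powr p) \<partial>\<eta>) \<le> ennreal (r powr p)"
    using assms(1) unfolding coupled_within_def by blast
  then have "prob_space \<eta>" "sets \<eta> = sets borel" "distr \<eta> borel fst = \<mu>" "distr \<eta> borel snd = \<nu>"
    "(\<integral>\<^sup>+z. ennreal (dist (fst z) (snd z) powr p) \<partial>\<eta>) \<le> ennreal (r powr p)"
    unfolding couplings_iff[OF \<mu>] by (auto simp: space_prob_algebra case_prod_beta')
  then show thesis by (intro that[unfolded borel_prod])
qed

lemma coupled_within_sym:
  fixes \<mu> \<nu> :: "'a::polish_space measure"
  assumes "coupled_within p r \<mu> \<nu>" and \<mu>: "sets \<mu> = sets borel" "sets \<nu> = sets borel"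
  shows "coupled_within p r \<nu> \<mu>"
proof -
  obtain \<eta> where \<eta>: "prob_space \<eta>" and [measurable_cong]: "sets \<eta> = sets (borel \<Otimes>\<^sub>M borel)"
    and marg: "distr \<eta> borel fst = \<mu>" "distr \<eta> borel snd = \<nu>"
    and "(\<integral>\<^sup>+z. ennreal (dist (fst z) (snd z) powr p) \<partial>\<eta>) \<le> ennreal (r powr p)"
    using coupled_withinE[OF assms] .
  then have "coupled_within p r (distr \<eta> borel snd) (distr \<eta> borel fst)"
    by (intro coupled_within_distr) (auto simp: dist_commute)
  then show ?thesis by (simp add: marg)
qed

lemma Wass_self:
  fixes \<mu> :: "'a::polish_space measure"
  assumes "p \<ge> 1" "prob_space \<mu>" "sets \<mu> = sets borel"
  shows "Wass p \<mu> \<mu> = 0"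
proof -
  have [measurable_cong]: "sets \<mu> = sets borel" by fact
  have eq: "distr \<mu> borel (\<lambda>x. x) = \<mu>" using assms by (intro distr_id2) simp
  have "coupled_within p 0 (distr \<mu> borel (\<lambda>x. x)) (distr \<mu> borel (\<lambda>x. x))"
    using assms by (intro coupled_within_distr) auto
  from Wass_le_of_coupled_within[OF assms(1) _ this] show ?thesis by (simp add: eq)
qed

subsection \<open>Gluing couplings\<close>

text \<open>The junk value \<open>M\<close> at null fibres keeps this a Markov kernel in \<open>i\<close>.\<close>

definition cond_on :: "'b measure \<Rightarrow> ('b \<Rightarrow> nat) \<Rightarrow> nat \<Rightarrow> 'b measure" where
  "cond_on M f i = (if emeasure M (f -` {i} \<inter> space M) = 0 then M
                    else uniform_measure M (f -` {i} \<inter> space M))"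

lemma nn_integral_nat_valued:
  assumes "f \<in> M \<rightarrow>\<^sub>M count_space (UNIV :: nat set)"
  shows "(\<integral>\<^sup>+x. c (f x) \<partial>M) = (\<Sum>i. c i * emeasure M (f -` {i} \<inter> space M))"
proof -
  have m: "f -` {i} \<inter> space M \<in> sets M" for i by (rule measurable_sets[OF assms]) simp
  have "(\<integral>\<^sup>+x. c (f x) \<partial>M) = (\<integral>\<^sup>+x. (\<Sum>i. c i * indicator (f -` {i} \<inter> space M) x) \<partial>M)"
    by (intro nn_integral_cong suminf_cmult_indicator[symmetric]) (auto simp: disjoint_family_on_def)
  also have "\<dots> = (\<Sum>i. c i * emeasure M (f -` {i} \<inter> space M))"
    by (subst nn_integral_suminf)
      (simp_all add: nn_integral_cmult_indicator m borel_measurable_times_ennreal borel_measurable_indicator)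
  finally show ?thesis .
qed

context prob_space
begin

lemma cond_on_prob_algebra: "cond_on M f i \<in> space (prob_algebra M)"
  unfolding space_prob_algebra cond_on_def
  by (auto simp: prob_space_axioms intro!: prob_space_uniform_measure emeasure_finite)

lemma measurable_cond_on:
  "cond_on M f \<in> count_space UNIV \<rightarrow>\<^sub>M prob_algebra M"
  using cond_on_prob_algebra by auto

lemma AE_cond_on_eq:
  assumes [measurable]: "f \<in> M \<rightarrow>\<^sub>M count_space UNIV"
    and "emeasure M (f -` {i} \<inter> space M) \<noteq> 0"
  shows "AE x in cond_on M f i. f x = i"
  unfolding cond_on_def using assms by (auto intro!: AE_uniform_measureI)

text \<open>There are only countably many fibres, so the null ones have a null union. Hence the
  default value in \<open>cond_on\<close> is almost never met.\<close>

lemma AE_fibre_not_null: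
  assumes [measurable]: "f \<in> M \<rightarrow>\<^sub>M count_space (UNIV :: nat set)"
  shows "AE x in M. emeasure M (f -` {f x} \<inter> space M) \<noteq> 0"
proof -
  have "AE x in M. \<forall>i. emeasure M (f -` {i} \<inter> space M) = 0 \<longrightarrow> f x \<noteq> i"
    unfolding AE_all_countable
  proof
    fix i :: nat
    show "AE x in M. emeasure M (f -` {i} \<inter> space M) = 0 \<longrightarrow> f x \<noteq> i"
    proof (cases "emeasure M (f -` {i} \<inter> space M) = 0")
      case True
      then have "f -` {i} \<inter> space M \<in> null_sets M"
        by (auto simp: null_sets_def)
      from AE_not_in[OF this] AE_space show ?thesis by eventually_elim auto
    qed auto
  qed
  then show ?thesis by eventually_elim auto
qed

text \<open>The law of total probability over the fibres of \<open>f\<close>. A null fibre has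
  weight 0, so the default value of \<open>cond_on\<close> there contributes nothing.\<close>

lemma bind_cond_on:
  assumes f[measurable]: "f \<in> M \<rightarrow>\<^sub>M count_space UNIV"
  shows "M \<bind> (\<lambda>x. cond_on M f (f x)) = M"
proof (rule measure_eqI)
  have K: "(\<lambda>x. cond_on M f (f x)) \<in> M \<rightarrow>\<^sub>M prob_algebra M"
    using measurable_compose[OF f measurable_cond_on] .
  have M: "M \<in> space (prob_algebra M)" by (simp add: space_prob_algebra prob_space_axioms)
  show "sets (M \<bind> (\<lambda>x. cond_on M f (f x))) = sets M"
    using sets_bind'[OF M K] .
  fix A assume "A \<in> sets (M \<bind> (\<lambda>x. cond_on M f (f x)))"
  then have A[measurable]: "A \<in> sets M" by (simp add: sets_bind'[OF M K])
  have "emeasure (M \<bind> (\<lambda>x. cond_on M f (f x))) A = (\<integral>\<^sup>+x. emeasure (cond_on M f (f x)) A \<partial>M)"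
    by (rule emeasure_bind_prob_algebra[OF M K A])
  also have "\<dots> = (\<Sum>i. emeasure (cond_on M f i) A * emeasure M (f -` {i} \<inter> space M))"
    by (rule nn_integral_nat_valued[OF f])
  also have "\<dots> = (\<Sum>i. emeasure M (f -` {i} \<inter> A))"
  proof (rule suminf_cong)
    fix i
    have "emeasure M (f -` {i} \<inter> A) \<le> emeasure M (f -` {i} \<inter> space M)"
      using sets.sets_into_space[OF A] by (intro emeasure_mono) auto
    moreover have "f -` {i} \<inter> space M \<inter> A = f -` {i} \<inter> A"
      using sets.sets_into_space[OF A] by auto
    ultimately show "emeasure (cond_on M f i) A * emeasure M (f -` {i} \<inter> space M)
        = emeasure M (f -` {i} \<inter> A)"
      by (cases "emeasure M (f -` {i} \<inter> space M) = 0")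
        (simp_all add: cond_on_def ennreal_divide_times ennreal_divide_self less_top[symmetric])
  qed
  also have "\<dots> = emeasure M (\<Union>i. f -` {i} \<inter> A)"
  proof (rule suminf_emeasure)
    have "f -` {i} \<inter> A = (f -` {i} \<inter> space M) \<inter> A" for i
      using sets.sets_into_space[OF A] by auto
    then show "range (\<lambda>i. f -` {i} \<inter> A) \<subseteq> sets M" by auto
  qed (auto simp: disjoint_family_on_def)
  also have "(\<Union>i. f -` {i} \<inter> A) = A" by auto
  finally show "emeasure (M \<bind> (\<lambda>x. cond_on M f (f x))) A = emeasure M A" .
qed

end

lemma ex_small_cells:
  assumes "e > 0"
  obtains s :: "nat \<Rightarrow> 'a::{metric_space, second_countable_topology}" and j :: "'a \<Rightarrow> nat"
  where "j \<in> borel \<rightarrow>\<^sub>M count_space UNIV" "\<And>y. dist y (s (j y)) < e"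
proof -
  obtain D :: "'a set" where D: "countable D" "\<And>X. open X \<Longrightarrow> X \<noteq> {} \<Longrightarrow> \<exists>d\<in>D. d \<in> X"
    using countable_dense_setE by blast
  define s where "s = from_nat_into D"
  \<comment> \<open>The cell of \<open>y\<close> is the first index of a dense sequence that comes
    within \<open>e\<close> of \<open>y\<close>; a least index over countably many open conditions
    is measurable.\<close>
  define j where "j y = (LEAST n. dist y (s n) < e)" for y
  have "\<exists>n. dist y (s n) < e" for y
  proof -
    obtain d where "d \<in> D" "dist y d < e" using D(2)[of "ball y e"] assms by auto
    then show ?thesis unfolding s_def using from_nat_into_to_nat_on[OF D(1)] by metis
  qed
  then have "dist y (s (j y)) < e" for y unfolding j_def by (rule LeastI_ex)
  moreover have "j \<in> borel \<rightarrow>\<^sub>M count_space UNIV"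
    unfolding j_def by (rule measurable_Least) measurable
  ultimately show thesis using that by blast
qed

lemma distr_pair_snd:
  assumes "prob_space M" "prob_space N"
  shows "distr (M \<Otimes>\<^sub>M N) N snd = N"
proof (rule measure_eqI)
  interpret M: prob_space M by fact
  interpret N: prob_space N by fact
  fix A assume "A \<in> sets (distr (M \<Otimes>\<^sub>M N) N snd)"
  then have A: "A \<in> sets N" by simp
  have "snd -` A \<inter> space (M \<Otimes>\<^sub>M N) = space M \<times> A"
    using sets.sets_into_space[OF A] by (auto simp: space_pair_measure)
  then show "emeasure (distr (M \<Otimes>\<^sub>M N) N snd) A = emeasure N A"
    using A by (simp add: emeasure_distr N.emeasure_pair_measure_Times M.emeasure_space_1)
qed simp

text \<open>The middle measure is only matched up to cells of small diameter, so gluing the two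
  couplings needs no disintegration.\<close>

lemma coupled_within_trans:
  fixes \<alpha> \<beta> \<gamma> :: "'a::polish_space measure"
  assumes p: "p \<ge> 1" and pos: "0 < r" "0 < s" "0 < e"
    and sets: "sets \<alpha> = sets borel" "sets \<beta> = sets borel" "sets \<gamma> = sets borel"
    and "coupled_within p r \<alpha> \<beta>" "coupled_within p s \<beta> \<gamma>"
  shows "coupled_within p (r + s + e) \<alpha> \<gamma>"
proof -
  obtain \<eta> where \<eta>: "prob_space \<eta>" and sets_\<eta>[measurable_cong]: "sets \<eta> = sets (borel \<Otimes>\<^sub>M borel)"
    and \<eta>1: "distr \<eta> borel fst = \<alpha>" and \<eta>2: "distr \<eta> borel snd = \<beta>"
    and \<eta>_le: "(\<integral>\<^sup>+z. ennreal (dist (fst z) (snd z) powr p) \<partial>\<eta>) \<le> ennreal (r powr p)"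
    using coupled_withinE[OF assms(8) sets(1,2)] .
  obtain \<zeta> where \<zeta>: "prob_space \<zeta>" and sets_\<zeta>[measurable_cong]: "sets \<zeta> = sets (borel \<Otimes>\<^sub>M borel)"
    and \<zeta>1: "distr \<zeta> borel fst = \<beta>" and \<zeta>2: "distr \<zeta> borel snd = \<gamma>"
    and \<zeta>_le: "(\<integral>\<^sup>+z. ennreal (dist (fst z) (snd z) powr p) \<partial>\<zeta>) \<le> ennreal (s powr p)"
    using coupled_withinE[OF assms(9) sets(2,3)] .
  interpret \<eta>: prob_space \<eta> by fact
  interpret \<zeta>: prob_space \<zeta> by fact
  obtain c :: "nat \<Rightarrow> 'a" and j :: "'a \<Rightarrow> nat"
    where j[measurable]: "j \<in> borel \<rightarrow>\<^sub>M count_space UNIV" and c: "\<And>y. dist y (c (j y)) < e / 2"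
    using ex_small_cells[OF half_gt_zero[OF pos(3)]] by metis
  have close: "dist y y' < e" if "j y = j y'" for y y'
    using c[of y] c[of y'] dist_triangle2[of y y' "c (j y)"] that by simp
  have \<beta>: "prob_space \<beta>" using \<eta>2 by (auto intro!: \<eta>.prob_space_distr)
  have [measurable_cong]: "sets \<beta> = sets borel" by fact
  have \<beta>_in: "\<beta> \<in> space (prob_algebra borel)" using \<beta> sets by (simp add: space_prob_algebra)
  have [simp]: "space \<beta> \<noteq> {}" using prob_space.not_empty[OF \<beta>] .
  define j1 where "j1 z = j (snd z)" for z :: "'a \<times> 'a"
  define j2 where "j2 z = j (fst z)" for z :: "'a \<times> 'a"
  have j12[measurable]: "j1 \<in> \<eta> \<rightarrow>\<^sub>M count_space UNIV" "j2 \<in> \<zeta> \<rightarrow>\<^sub>M count_space UNIV"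
    unfolding j1_def j2_def by measurable
  have K1: "(\<lambda>y. cond_on \<eta> j1 (j y)) \<in> borel \<rightarrow>\<^sub>M prob_algebra \<eta>"
    using measurable_compose[OF j \<eta>.measurable_cond_on] .
  have K2: "(\<lambda>y. cond_on \<zeta> j2 (j y)) \<in> borel \<rightarrow>\<^sub>M prob_algebra \<zeta>"
    using measurable_compose[OF j \<zeta>.measurable_cond_on] .
  \<comment> \<open>Given the cell of a middle point, the two coupled pairs are drawn independently,
    each conditioned on having its own middle coordinate in that cell.\<close>
  define G where "G y = cond_on \<eta> j1 (j y) \<Otimes>\<^sub>M cond_on \<zeta> j2 (j y)" for y
  have G: "G \<in> borel \<rightarrow>\<^sub>M prob_algebra (\<eta> \<Otimes>\<^sub>M \<zeta>)"
    unfolding G_def using K1 K2 by (rule measurable_pair_prob)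
  have G': "G \<in> \<beta> \<rightarrow>\<^sub>M subprob_algebra (\<eta> \<Otimes>\<^sub>M \<zeta>)"
    using measurable_prob_algebraD[OF G] by measurable
  have sp1: "prob_space (cond_on \<eta> j1 i)" and se1: "sets (cond_on \<eta> j1 i) = sets \<eta>" for i
    using \<eta>.cond_on_prob_algebra[of j1 i] by (auto simp: space_prob_algebra)
  have sp2: "prob_space (cond_on \<zeta> j2 i)" and se2: "sets (cond_on \<zeta> j2 i) = sets \<zeta>" for i
    using \<zeta>.cond_on_prob_algebra[of j2 i] by (auto simp: space_prob_algebra)
  have G1: "distr (G y) \<eta> fst = cond_on \<eta> j1 (j y)" for y
    unfolding G_def using prob_space.distr_pair_fst[OF sp2, of "cond_on \<eta> j1 (j y)"]
    by (metis distr_cong se1)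
  have G2: "distr (G y) \<zeta> snd = cond_on \<zeta> j2 (j y)" for y
    unfolding G_def using distr_pair_snd[OF sp1 sp2] by (metis distr_cong se2)
  define \<Omega> where "\<Omega> = \<beta> \<bind> G"
  have \<Omega>: "prob_space \<Omega>" and [measurable_cong]: "sets \<Omega> = sets (\<eta> \<Otimes>\<^sub>M \<zeta>)"
    unfolding \<Omega>_def using prob_space_bind'[OF \<beta>_in G] sets_bind'[OF \<beta>_in G] by auto
  \<comment> \<open>The cell is drawn with law \<beta>, which is also the middle marginal of \<eta>,
    so averaging the conditional laws of \<eta> over cells restores \<eta>. The same holds for
    \<zeta>.\<close>
  have \<Omega>1: "distr \<Omega> \<eta> fst = \<eta>"
  proof -
    have "distr \<Omega> \<eta> fst = distr \<eta> borel snd \<bind> (\<lambda>y. cond_on \<eta> j1 (j y))"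
      unfolding \<Omega>_def \<eta>2 by (subst distr_bind[OF G']) (auto simp: G1)
    also have "\<dots> = \<eta> \<bind> (\<lambda>z. cond_on \<eta> j1 (j (snd z)))"
      by (subst bind_distr[OF _ measurable_prob_algebraD[OF K1]]) (auto simp: \<eta>.not_empty)
    also have "\<dots> = \<eta>" unfolding j1_def[of z for z, symmetric] by (rule \<eta>.bind_cond_on) fact
    finally show ?thesis .
  qed
  have \<Omega>2: "distr \<Omega> \<zeta> snd = \<zeta>"
  proof -
    have "distr \<Omega> \<zeta> snd = distr \<zeta> borel fst \<bind> (\<lambda>y. cond_on \<zeta> j2 (j y))"
      unfolding \<Omega>_def \<zeta>1 by (subst distr_bind[OF G']) (auto simp: G2)
    also have "\<dots> = \<zeta> \<bind> (\<lambda>z. cond_on \<zeta> j2 (j (fst z)))"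
      by (subst bind_distr[OF _ measurable_prob_algebraD[OF K2]]) (auto simp: \<zeta>.not_empty)
    also have "\<dots> = \<zeta>" unfolding j2_def[of z for z, symmetric] by (rule \<zeta>.bind_cond_on) fact
    finally show ?thesis .
  qed
  have \<Omega>_close: "AE \<omega> in \<Omega>. dist (snd (fst \<omega>)) (fst (snd \<omega>)) \<le> e"
  proof -
    \<comment> \<open>On a null cell \<open>cond_on\<close> is the unconditioned measure and the two
      middle points need not match. Since \<beta> is the middle marginal of both couplings,
      \<beta>-almost every point lies in a cell that both of them charge.\<close>
    define pos1 where "pos1 i \<longleftrightarrow> emeasure \<eta> (j1 -` {i} \<inter> space \<eta>) \<noteq> 0" for i
    define pos2 where "pos2 i \<longleftrightarrow> emeasure \<zeta> (j2 -` {i} \<inter> space \<zeta>) \<noteq> 0" for i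
    have "AE y in distr \<eta> borel snd. pos1 (j y)"
      using \<eta>.AE_fibre_not_null[OF j12(1)] by (simp add: AE_distr_iff pos1_def j1_def)
    moreover have "AE y in distr \<zeta> borel fst. pos2 (j y)"
      using \<zeta>.AE_fibre_not_null[OF j12(2)] by (simp add: AE_distr_iff pos2_def j2_def)
    ultimately have "AE y in \<beta>. AE \<omega> in G y. dist (snd (fst \<omega>)) (fst (snd \<omega>)) \<le> e"
      unfolding \<eta>2 \<zeta>1
    proof eventually_elim
      case (elim y)
      have [measurable_cong]: "sets (G y) = sets (\<eta> \<Otimes>\<^sub>M \<zeta>)"
        unfolding G_def by (intro sets_pair_measure_cong se1 se2)
      have "AE z in distr (G y) \<eta> fst. j1 z = j y"
        unfolding G1 using elim by (intro \<eta>.AE_cond_on_eq) (auto simp: pos1_def)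
      then have "AE \<omega> in G y. j1 (fst \<omega>) = j y" by (rule AE_distrD[rotated]) measurable
      moreover have "AE z in distr (G y) \<zeta> snd. j2 z = j y"
        unfolding G2 using elim by (intro \<zeta>.AE_cond_on_eq) (auto simp: pos2_def)
      then have "AE \<omega> in G y. j2 (snd \<omega>) = j y" by (rule AE_distrD[rotated]) measurable
      ultimately show ?case
        by eventually_elim (auto simp: j1_def j2_def intro!: less_imp_le close)
    qed
    then show ?thesis unfolding \<Omega>_def by (subst AE_bind[OF G']) measurable
  qed
  have "coupled_within p (r + e + s) (distr \<Omega> borel (\<lambda>\<omega>. fst (fst \<omega>))) (distr \<Omega> borel (\<lambda>\<omega>. snd (snd \<omega>)))"
  proof (rule coupled_within_distr[OF \<Omega>])
    \<comment> \<open>The gap \<open>e\<close> between the two middle points is booked with the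
      first leg, so Minkowski is applied twice: once to absorb \<open>e\<close>, once to add the
      legs.\<close>
    let ?f = "\<lambda>\<omega>. dist (fst (fst \<omega>)) (snd (fst \<omega>)) + e"
    let ?g = "\<lambda>\<omega>. dist (fst (snd \<omega>)) (snd (snd \<omega>))"
    have [measurable]: "fst \<in> \<Omega> \<rightarrow>\<^sub>M \<eta>" "snd \<in> \<Omega> \<rightarrow>\<^sub>M \<zeta>" by measurable
    have 1: "(\<integral>\<^sup>+\<omega>. ennreal (dist (fst (fst \<omega>)) (snd (fst \<omega>)) powr p) \<partial>\<Omega>) \<le> ennreal (r powr p)"
      using \<eta>_le by (subst (asm) \<Omega>1[symmetric]) (simp add: nn_integral_distr)
    have 2: "(\<integral>\<^sup>+\<omega>. ennreal (?g \<omega> powr p) \<partial>\<Omega>) \<le> ennreal (s powr p)"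
      using \<zeta>_le by (subst (asm) \<Omega>2[symmetric]) (simp add: nn_integral_distr)
    have 3: "(\<integral>\<^sup>+\<omega>. ennreal (?f \<omega> powr p) \<partial>\<Omega>) \<le> ennreal ((r + e) powr p)"
      using 1 pos p by (intro nn_integral_Minkowski) (auto simp: prob_space.emeasure_space_1[OF \<Omega>])
    have "AE \<omega> in \<Omega>. dist (fst (fst \<omega>)) (snd (snd \<omega>)) \<le> ?f \<omega> + ?g \<omega>"
      using \<Omega>_close
    proof eventually_elim
      case (elim \<omega>)
      then show ?case
        using dist_triangle[of "fst (fst \<omega>)" "snd (snd \<omega>)" "snd (fst \<omega>)"]
          dist_triangle[of "snd (fst \<omega>)" "snd (snd \<omega>)" "fst (snd \<omega>)"] by linarith
    qed
    then have "(\<integral>\<^sup>+\<omega>. ennreal (dist (fst (fst \<omega>)) (snd (snd \<omega>)) powr p) \<partial>\<Omega>)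
        \<le> (\<integral>\<^sup>+\<omega>. ennreal ((?f \<omega> + ?g \<omega>) powr p) \<partial>\<Omega>)"
      using p by (intro nn_integral_mono_AE) (auto elim!: eventually_mono intro!: ennreal_leI powr_mono2)
    also have "\<dots> \<le> ennreal ((r + e + s) powr p)"
      using 2 3 pos p by (intro nn_integral_Minkowski[where f="?f" and g="?g"]) auto
    finally show "(\<integral>\<^sup>+\<omega>. ennreal (dist (fst (fst \<omega>)) (snd (snd \<omega>)) powr p) \<partial>\<Omega>)
        \<le> ennreal ((r + e + s) powr p)" .
  qed measurable
  moreover have "distr \<Omega> borel (\<lambda>\<omega>. fst (fst \<omega>)) = \<alpha>"
    using distr_distr[of fst \<eta> borel fst \<Omega>] by (simp add: \<Omega>1 \<eta>1 o_def)
  moreover have "distr \<Omega> borel (\<lambda>\<omega>. snd (snd \<omega>)) = \<gamma>"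
    using distr_distr[of snd \<zeta> borel snd \<Omega>] by (simp add: \<Omega>2 \<zeta>2 o_def)
  ultimately show ?thesis by (simp add: add_ac)
qed

lemma Wass_triangle:
  fixes \<alpha> \<beta> \<gamma> :: "'a::polish_space measure"
  assumes p: "p \<ge> 1"
    and sets: "sets \<alpha> = sets borel" "sets \<beta> = sets borel" "sets \<gamma> = sets borel"
  shows "Wass p \<alpha> \<gamma> \<le> Wass p \<alpha> \<beta> + Wass p \<beta> \<gamma>"
proof (cases "Wass p \<alpha> \<beta> = \<infinity> \<or> Wass p \<beta> \<gamma> = \<infinity>")
  case False
  then obtain r s where r: "Wass p \<alpha> \<beta> = ennreal r" "0 \<le> r" and s: "Wass p \<beta> \<gamma> = ennreal s" "0 \<le> s"
    by (metis ennreal_cases infinity_ennreal_def)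
  have "Wass p \<alpha> \<gamma> \<le> ennreal (r + s) + ennreal e" if e: "e > 0" for e
  proof -
    \<comment> \<open>Two thirds of \<open>e\<close> make the two bounds strict, so that couplings
      exist; the last third pays for the mismatch inside a cell.\<close>
    have "coupled_within p (r + e / 3) \<alpha> \<beta>" "coupled_within p (s + e / 3) \<beta> \<gamma>"
      using p r s e by (auto intro!: coupled_within_of_Wass_less simp: ennreal_less_iff)
    then have "coupled_within p ((r + e / 3) + (s + e / 3) + e / 3) \<alpha> \<gamma>"
      using r s e by (intro coupled_within_trans[OF p _ _ _ sets]) auto
    then have "coupled_within p (r + s + e) \<alpha> \<gamma>"
      by (rule back_subst[where P="\<lambda>x. coupled_within p x \<alpha> \<gamma>"]) (simp add: field_simps)
    from Wass_le_of_coupled_within[OF p _ this] show ?thesis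
      using r(2) s(2) e by (simp flip: ennreal_plus)
  qed
  then have "Wass p \<alpha> \<gamma> \<le> ennreal (r + s)" by (rule ennreal_le_epsilon)
  then show ?thesis using r s by simp
qed auto

lemma Wass_sym:
  fixes \<mu> \<nu> :: "'a::polish_space measure"
  assumes p: "p \<ge> 1" and sets: "sets \<mu> = sets borel" "sets \<nu> = sets borel"
  shows "Wass p \<mu> \<nu> = Wass p \<nu> \<mu>"
proof -
  have "Wass p \<mu> \<nu> \<le> Wass p \<nu> \<mu>"
    if sets: "sets \<mu> = sets borel" "sets \<nu> = sets borel" for \<mu> \<nu> :: "'a measure"
  proof (cases "Wass p \<nu> \<mu> = \<infinity>")
    case False
    then obtain r where r: "Wass p \<nu> \<mu> = ennreal r" "0 \<le> r"
      by (metis ennreal_cases infinity_ennreal_def)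
    have "Wass p \<mu> \<nu> \<le> ennreal r + ennreal e" if "e > 0" for e
    proof -
      have "coupled_within p (r + e) \<nu> \<mu>"
        using p r that by (auto intro!: coupled_within_of_Wass_less simp: ennreal_less_iff)
      from Wass_le_of_coupled_within[OF p _ coupled_within_sym[OF this sets(2,1)]] show ?thesis
        using r(2) that by simp
    qed
    then have "Wass p \<mu> \<nu> \<le> ennreal r" by (rule ennreal_le_epsilon)
    then show ?thesis using r by simp
  qed auto
  then show ?thesis using sets by (intro antisym) auto
qed

subsection \<open>Local Lipschitz maps on length spaces\<close>

text \<open>Compactness of [0,1] enters by bisection (\<open>Bolzano\<close>): having a subdivision
  whose polygonal sum dominates \<open>D\<close> is stable under concatenation and holds on short
  intervals. \<open>D\<close> lives on parameters; it will be the distance between the images of two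
  points of the curve.\<close>

lemma le_curve_length:
  fixes \<gamma> :: "real \<Rightarrow> 'a::metric_space" and D :: "real \<Rightarrow> real \<Rightarrow> ennreal"
  assumes "path \<gamma>" and sym: "\<And>a b. D a b = D b a"
    and triangle: "\<And>a b c. D a c \<le> D a b + D b c"
    and local: "\<And>x. x \<in> {0..1} \<Longrightarrow> \<exists>e>0. \<forall>y. dist (\<gamma> x) (\<gamma> y) < e \<longrightarrow> D x y \<le> K * ennreal (dist (\<gamma> x) (\<gamma> y))"
  shows "D 0 1 \<le> K * curve_length 0 1 \<gamma>"
proof -
  define S where "S t m = (\<Sum>i<m. ennreal (dist (\<gamma> (t i)) (\<gamma> (t (Suc i)))))" for t :: "nat \<Rightarrow> real" and m
  \<comment> \<open>The guard makes \<open>Q\<close> void on intervals that leave [0,1], since the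
    local condition in \<open>Bolzano\<close> also ranges over those.\<close>
  define Q where "Q a b \<longleftrightarrow> 0 \<le> a \<and> a \<le> b \<and> b \<le> 1 \<longrightarrow>
    (\<exists>t m. t 0 = a \<and> t m = b \<and> mono_on {..m} t \<and> D a b \<le> K * S t m)" for a b
  have "Q 0 1"
  proof (rule Bolzano)
    fix a b c assume Q: "Q a b" "Q b c" and ord: "a \<le> b" "b \<le> c"
    show "Q a c"
      unfolding Q_def
    proof
      assume "0 \<le> a \<and> a \<le> c \<and> c \<le> 1"
      then obtain s m t n where
        s: "s 0 = a" "s m = b" "mono_on {..m} s" "D a b \<le> K * S s m" and
        t: "t 0 = b" "t n = c" "mono_on {..n} t" "D b c \<le> K * S t n"
        using Q ord unfolding Q_def by (smt (verit))
      \<comment> \<open>The point \<open>b\<close> occurs in both lists, as \<open>s m\<close> and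
        as \<open>t 0\<close>; the second list is shifted by \<open>m\<close> and its first entry is
        merged with the last of the first.\<close>
      define u where "u i = (if i \<le> m then s i else t (i - m))" for i
      have u_right: "u (i + m) = t i" for i using s t by (auto simp: u_def)
      have "S u (n + m) = S u m + (\<Sum>i<n. ennreal (dist (\<gamma> (u (i + m))) (\<gamma> (u (Suc i + m)))))"
        unfolding S_def by (induction n) (auto simp: add_ac)
      also have "(\<Sum>i<n. ennreal (dist (\<gamma> (u (i + m))) (\<gamma> (u (Suc i + m))))) = S t n"
        unfolding S_def u_right ..
      also have "S u m = S s m" unfolding S_def by (intro sum.cong) (auto simp: u_def)
      finally have S: "S u (n + m) = S s m + S t n" .
      have "mono_on {..n + m} u"
      proof (rule mono_onI)
        fix i k assume ik: "i \<in> {..n + m}" "k \<in> {..n + m}" "i \<le> k"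
        have "s i \<le> b" if "i \<le> m" using mono_onD[OF s(3), of i m] s(2) that by auto
        moreover have "b \<le> t (k - m)" using mono_onD[OF t(3), of 0 "k - m"] t(1) ik by auto
        moreover have "s i \<le> s k" if "k \<le> m" using mono_onD[OF s(3), of i k] ik that by auto
        moreover have "t (i - m) \<le> t (k - m)" using mono_onD[OF t(3), of "i - m" "k - m"] ik by auto
        ultimately show "u i \<le> u k" using ik by (auto simp: u_def)
      qed
      moreover have "D a c \<le> K * S u (n + m)"
        using order_trans[OF triangle[of a c b] add_mono[OF s(4) t(4)]] by (simp add: S distrib_left)
      ultimately show "\<exists>t m. t 0 = a \<and> t m = c \<and> mono_on {..m} t \<and> D a c \<le> K * S t m"
        using s(1) t(2) u_right[of n] by (intro exI[of _ u] exI[of _ "n + m"]) (auto simp: u_def)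
    qed
  next
    fix x :: real assume x: "0 \<le> x" "x \<le> 1"
    then obtain e where e: "e > 0"
      "\<And>y. dist (\<gamma> x) (\<gamma> y) < e \<Longrightarrow> D x y \<le> K * ennreal (dist (\<gamma> x) (\<gamma> y))"
      using local[of x] by auto
    have "continuous_on {0..1} \<gamma>" using \<open>path \<gamma>\<close> by (simp add: path_def)
    then obtain d where d: "d > 0" "\<And>y. y \<in> {0..1} \<Longrightarrow> dist y x < d \<Longrightarrow> dist (\<gamma> y) (\<gamma> x) < e"
      using x e(1) unfolding continuous_on_iff by (meson atLeastAtMost_iff)
    show "\<exists>d>0. \<forall>a b. a \<le> x \<and> x \<le> b \<and> b - a < d \<longrightarrow> Q a b"
    proof (intro exI conjI allI impI)
      show "d > 0" by fact
      fix a b assume ab: "a \<le> x \<and> x \<le> b \<and> b - a < d"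
      show "Q a b"
        unfolding Q_def
      proof
        assume ab': "0 \<le> a \<and> a \<le> b \<and> b \<le> 1"
        \<comment> \<open>The radius \<open>e\<close> belongs to the one point \<open>x\<close> and
          controls only distances from \<open>x\<close>, so the subdivision of a short interval has
          to pass through \<open>x\<close>.\<close>
        define t where "t i = (if i = 0 then a else if i = 1 then x else b)" for i :: nat
        have "dist (\<gamma> a) (\<gamma> x) < e" "dist (\<gamma> b) (\<gamma> x) < e"
          using ab ab' by (auto intro!: d(2) simp: dist_real_def)
        then have "D x a \<le> K * ennreal (dist (\<gamma> x) (\<gamma> a))" "D x b \<le> K * ennreal (dist (\<gamma> x) (\<gamma> b))"
          using e(2)[of a] e(2)[of b] by (simp_all add: dist_commute)
        then have "D a x + D x b \<le> K * ennreal (dist (\<gamma> a) (\<gamma> x)) + K * ennreal (dist (\<gamma> x) (\<gamma> b))"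
          by (intro add_mono) (auto simp: sym[of a x] dist_commute)
        also have "\<dots> = K * S t 2"
          by (simp add: S_def t_def numeral_2_eq_2 distrib_left)
        finally have "D a b \<le> K * S t 2" using triangle[of a b x] by (rule order_trans[rotated])
        moreover have "mono_on {..2} t" using ab by (auto simp: mono_on_def t_def)
        ultimately show "\<exists>t m. t 0 = a \<and> t m = b \<and> mono_on {..m} t \<and> D a b \<le> K * S t m"
          by (intro exI[of _ t] exI[of _ 2]) (auto simp: t_def)
      qed
    qed
  qed simp
  then obtain t m where t: "t 0 = 0" "t m = 1" "mono_on {..m} t" "D 0 1 \<le> K * S t m"
    unfolding Q_def by auto
  have "S t m = (\<Sum>i=1..m. ennreal (dist (\<gamma> (t (i - 1))) (\<gamma> (t i))))"
    unfolding S_def sum_bounds_lt_plus1[symmetric] by simp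
  also have "\<dots> \<le> curve_length 0 1 \<gamma>"
    unfolding curve_length_def using t
    by (intro SUP_upper2[of "(m, t)"]) auto
  finally show ?thesis using t(4) by (meson mult_left_mono order_trans zero_le)
qed

text \<open>Slack is introduced twice: a limsup at most C gives slope at most C + e on some ball
  around each point, and a curve of length below \<open>dist x y + e\<close> joins the endpoints.
  Summing along the curve and letting e tend to 0 gives the constant C.\<close>

lemma lipschitz_of_locally_lipschitz:
  fixes f :: "'a::length_space \<Rightarrow> 'b" and D :: "'b \<Rightarrow> 'b \<Rightarrow> ennreal"
  assumes "locally_lipschitz C D f" and C: "0 \<le> C"
    and self: "\<And>x. D (f x) (f x) = 0" and sym: "\<And>x y. D (f x) (f y) = D (f y) (f x)"
    and triangle: "\<And>x y z. D (f x) (f z) \<le> D (f x) (f y) + D (f y) (f z)"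
  shows "D (f x) (f y) \<le> ennreal (C * dist x y)"
proof -
  have *: "D (f x) (f y) \<le> ennreal ((C + e) * (dist x y + e))" if e: "e > 0" for e
  proof -
    have "(INF \<gamma> \<in> {\<gamma>. path \<gamma> \<and> pathstart \<gamma> = x \<and> pathfinish \<gamma> = y}. curve_length 0 1 \<gamma>)
        < ennreal (dist x y + e)"
      unfolding dist_eq_INF_curve_length[symmetric] using e by (simp add: ennreal_less_iff)
    then obtain \<gamma> where \<gamma>: "path \<gamma>" "\<gamma> 0 = x" "\<gamma> 1 = y" "curve_length 0 1 \<gamma> < ennreal (dist x y + e)"
      by (auto simp: INF_less_iff pathstart_def pathfinish_def)
    have local: "\<And>x. \<exists>d>0. \<forall>z. dist x z < d \<longrightarrow> D (f x) (f z) \<le> ennreal (C + e) * ennreal (dist x z)"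
    proof -
      fix x
      have "Limsup (at x) (\<lambda>z. D (f x) (f z) / ennreal (dist x z)) < ennreal (C + e)"
        using assms(1) e C unfolding locally_lipschitz_def
        by (meson ennreal_lessI le_less_trans less_add_same_cancel1 add_nonneg_pos)
      from Limsup_lessD[OF this] obtain d where "d > 0"
        and d: "\<And>z. z \<noteq> x \<Longrightarrow> dist z x < d \<Longrightarrow> D (f x) (f z) / ennreal (dist x z) < ennreal (C + e)"
        unfolding eventually_at by auto
      have "D (f x) (f z) \<le> ennreal (C + e) * ennreal (dist x z)" if "dist x z < d" for z
      \<comment> \<open>The filter \<open>at x\<close> says nothing about the centre itself; there
        \<open>self\<close> gives the bound.\<close>
      proof (cases "z = x")
        case False
        with d[of z] that have "D (f x) (f z) / ennreal (dist x z) \<le> ennreal (C + e)"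
          by (auto simp: dist_commute)
        then have "D (f x) (f z) / ennreal (dist x z) * ennreal (dist x z)
            \<le> ennreal (C + e) * ennreal (dist x z)"
          by (rule mult_right_mono) simp
        then show ?thesis using False by (simp add: ennreal_divide_times ennreal_divide_self)
      qed (simp add: self)
      then show "\<exists>d>0. \<forall>z. dist x z < d \<longrightarrow> D (f x) (f z) \<le> ennreal (C + e) * ennreal (dist x z)"
        using \<open>d > 0\<close> by blast
    qed
    have "D (f (\<gamma> 0)) (f (\<gamma> 1)) \<le> ennreal (C + e) * curve_length 0 1 \<gamma>"
    proof (rule le_curve_length[OF \<gamma>(1)])
      show "\<exists>d>0. \<forall>t. dist (\<gamma> s) (\<gamma> t) < d \<longrightarrow>
          D (f (\<gamma> s)) (f (\<gamma> t)) \<le> ennreal (C + e) * ennreal (dist (\<gamma> s) (\<gamma> t))" for s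
        using local[of "\<gamma> s"] by blast
    qed (rule sym triangle)+
    also have "\<dots> \<le> ennreal (C + e) * ennreal (dist x y + e)"
      using \<gamma>(4) by (intro mult_left_mono) auto
    finally show ?thesis using \<gamma>(2,3) e C by (simp add: ennreal_mult)
  qed
  show ?thesis
  proof (rule ennreal_le_epsilon)
    fix e :: real assume e: "0 < e"
    \<comment> \<open>Chosen so that the error \<open>d * (C + dist x y + d)\<close> is at most
      \<open>e\<close>; the cap 1 makes the inner \<open>d\<close> harmless.\<close>
    define d where "d = min 1 (e / (C + dist x y + 1))"
    have d: "0 < d" "d \<le> 1" "d \<le> e / (C + dist x y + 1)" using e C by (auto simp: d_def add_nonneg_pos)
    have "(C + d) * (dist x y + d) = C * dist x y + d * (C + dist x y + d)" by (simp add: algebra_simps)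
    also have "d * (C + dist x y + d) \<le> d * (C + dist x y + 1)"
      using d by (intro mult_left_mono) auto
    also have "\<dots> \<le> e"
      using d(3) C by (simp add: pos_le_divide_eq add_nonneg_pos)
    finally have "ennreal ((C + d) * (dist x y + d)) \<le> ennreal (C * dist x y + e)"
      by (intro ennreal_leI) simp
    then show "D (f x) (f y) \<le> ennreal (C * dist x y) + ennreal e"
      using *[OF d(1)] e C by (simp add: order_trans)
  qed
qed

subsection \<open>Partitioning the space of measures\<close>

text \<open>Probability measures that put at least the mass \<open>w i\<close> on the \<open>i\<close>-th cell and whose \<open>p\<close>-th
  moment exceeds by at most \<open>\<kappa>\<close> the share of these masses. Both conditions are affine, so the set
  is closed under mixtures; and its diameter is small, as everything can be transported to
  \<open>\<Sum>i. w i \<delta>\<^bsub>c i\<^esub>\<close> plus an atom at \<open>z\<close>.\<close>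

definition mass_class ::
    "real \<Rightarrow> 'a::polish_space \<Rightarrow> ('a \<Rightarrow> nat) \<Rightarrow> (nat \<Rightarrow> real) \<Rightarrow> real \<Rightarrow> (nat \<Rightarrow> real) \<Rightarrow> 'a measure set" where
  "mass_class p z j l \<kappa> w = {\<alpha>. prob_space \<alpha> \<and> sets \<alpha> = sets borel \<and>
     (\<forall>i. ennreal (w i) \<le> emeasure \<alpha> (j -` {i})) \<and>
     (\<integral>\<^sup>+y. ennreal (dist z y powr p) \<partial>\<alpha>) \<le> ennreal \<kappa> + (\<Sum>i. ennreal (w i * l i))}"

text \<open>Each inequality is integrated against \<open>M\<close>, whose total mass 1 leaves the
  constant side unchanged. Almost sure membership is what conditioning on a fibre provides.\<close>

lemma bind_mass_class:
  assumes P: "P \<in> borel \<rightarrow>\<^sub>M prob_algebra borel" and M: "prob_space M" and sets: "sets M = sets borel"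
    and [measurable]: "j \<in> borel \<rightarrow>\<^sub>M count_space UNIV"
    and AE: "AE x in M. P x \<in> mass_class p z j l \<kappa> w"
  shows "M \<bind> P \<in> mass_class p z j l \<kappa> w"
proof -
  interpret prob_space M by fact
  have M_in: "M \<in> space (prob_algebra borel)" using M sets by (simp add: space_prob_algebra)
  have P': "P \<in> M \<rightarrow>\<^sub>M subprob_algebra borel"
    using measurable_prob_algebraD[OF P] sets by (simp cong: measurable_cong_sets)
  have "ennreal (w i) \<le> emeasure (M \<bind> P) (j -` {i})" for i
  proof -
    have j: "j -` {i} \<in> sets borel" using measurable_sets[OF assms(4), of "{i}"] by simp
    have "ennreal (w i) = (\<integral>\<^sup>+x. ennreal (w i) \<partial>M)" by (simp add: emeasure_space_1)
    also have "\<dots> \<le> (\<integral>\<^sup>+x. emeasure (P x) (j -` {i}) \<partial>M)"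
      using AE by (intro nn_integral_mono_AE) (auto simp: mass_class_def)
    finally show ?thesis by (simp add: emeasure_bind_prob_algebra[OF M_in P j])
  qed
  moreover have "(\<integral>\<^sup>+y. ennreal (dist z y powr p) \<partial>(M \<bind> P)) \<le> ennreal \<kappa> + (\<Sum>i. ennreal (w i * l i))"
  proof -
    have "(\<integral>\<^sup>+y. ennreal (dist z y powr p) \<partial>(M \<bind> P))
        = (\<integral>\<^sup>+x. \<integral>\<^sup>+y. ennreal (dist z y powr p) \<partial>P x \<partial>M)"
      by (rule nn_integral_bind[OF _ P']) measurable
    also have "\<dots> \<le> (\<integral>\<^sup>+x. ennreal \<kappa> + (\<Sum>i. ennreal (w i * l i)) \<partial>M)"
      using AE by (intro nn_integral_mono_AE) (auto simp: mass_class_def)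
    finally show ?thesis by (simp add: emeasure_space_1)
  qed
  ultimately show ?thesis
    using prob_space_bind'[OF M_in P] sets_bind'[OF M_in P] by (simp add: mass_class_def)
qed

text \<open>Membership is a countable conjunction of inequalities between measurable functions of
  \<open>x\<close>; this will make the pieces of the partition Borel.\<close>

lemma mass_class_measurable:
  assumes P: "P \<in> borel \<rightarrow>\<^sub>M prob_algebra borel"
    and j: "j \<in> borel \<rightarrow>\<^sub>M count_space UNIV"
  shows "Measurable.pred borel (\<lambda>x. P x \<in> mass_class p z j l \<kappa> w)"
proof -
  have P'[measurable]: "P \<in> borel \<rightarrow>\<^sub>M subprob_algebra borel"
    using measurable_prob_algebraD[OF P] .
  have j': "j -` {i} \<in> sets borel" for i using measurable_sets[OF j, of "{i}"] by simp
  have [measurable]: "(\<lambda>x. emeasure (P x) (j -` {i})) \<in> borel_measurable borel" for i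
    using j'[of i] by measurable
  have [measurable]: "(\<lambda>x. \<integral>\<^sup>+y. ennreal (dist z y powr p) \<partial>P x) \<in> borel_measurable borel"
    using nn_integral_measurable_subprob_algebra[of "\<lambda>y. ennreal (dist z y powr p)"] by measurable
  have "prob_space (P x) \<and> sets (P x) = sets borel" for x
    using measurable_space[OF P, of x] by (auto simp: space_prob_algebra)
  then show ?thesis unfolding mass_class_def by simp
qed

section \<open>Transport of a mass class to a common atomic measure\<close>

text \<open>A coin with bias \<open>\<theta> y\<close> is attached to each point \<open>y\<close>.
  Only a prescribed share of a cell may move to its centre, and a map of \<open>y\<close> alone
  cannot split the mass of an atom.\<close>

lemma two_point_randomisation:
  assumes M: "prob_space M" and [measurable]: "\<theta> \<in> borel_measurable M"
    and \<theta>: "\<And>y. 0 \<le> \<theta> y" "\<And>y. \<theta> y \<le> (1::real)"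
  obtains \<Omega> where "prob_space \<Omega>" "sets \<Omega> = sets (M \<Otimes>\<^sub>M count_space (UNIV :: bool set))" "distr \<Omega> M fst = M"
    "\<And>F. F \<in> borel_measurable (M \<Otimes>\<^sub>M count_space UNIV) \<Longrightarrow>
       (\<integral>\<^sup>+\<omega>. F \<omega> \<partial>\<Omega>) = (\<integral>\<^sup>+y. ennreal (\<theta> y) * F (y, True) + ennreal (1 - \<theta> y) * F (y, False) \<partial>M)"
proof -
  interpret prob_space M by fact
  interpret B: sigma_finite_measure "count_space (UNIV :: bool set)"
    by (rule sigma_finite_measure_count_space_countable) simp
  define \<Omega> where "\<Omega> = density (M \<Otimes>\<^sub>M count_space (UNIV :: bool set))
    (\<lambda>\<omega>. ennreal (if snd \<omega> then \<theta> (fst \<omega>) else 1 - \<theta> (fst \<omega>)))"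
  have sets[measurable_cong]: "sets \<Omega> = sets (M \<Otimes>\<^sub>M count_space (UNIV :: bool set))"
    by (simp add: \<Omega>_def)
  have int: "(\<integral>\<^sup>+\<omega>. F \<omega> \<partial>\<Omega>) = (\<integral>\<^sup>+y. ennreal (\<theta> y) * F (y, True) + ennreal (1 - \<theta> y) * F (y, False) \<partial>M)"
    if [measurable]: "F \<in> borel_measurable (M \<Otimes>\<^sub>M count_space UNIV)" for F
    unfolding \<Omega>_def
    by (subst nn_integral_density, measurable, subst B.nn_integral_fst[symmetric], measurable)
      (simp add: nn_integral_count_space_finite UNIV_bool add.commute)
  have sum: "ennreal (\<theta> y) * c + ennreal (1 - \<theta> y) * c = c" for y c
    using \<theta>[of y] by (simp flip: distrib_right ennreal_plus)
  have distr: "distr \<Omega> M fst = M"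
  proof (rule measure_eqI)
    fix A assume "A \<in> sets (distr \<Omega> M fst)"
    then have [measurable]: "A \<in> sets M" by simp
    have "emeasure (distr \<Omega> M fst) A = (\<integral>\<^sup>+x. indicator A x \<partial>distr \<Omega> M fst)" by simp
    also have "\<dots> = (\<integral>\<^sup>+\<omega>. indicator A (fst \<omega>) \<partial>\<Omega>)" by (subst nn_integral_distr) auto
    also have "\<dots> = emeasure M A" by (subst int) (auto simp: sum)
    finally show "emeasure (distr \<Omega> M fst) A = emeasure M A" .
  qed simp
  have "prob_space (distr \<Omega> M fst)" unfolding distr by fact
  then have "prob_space \<Omega>" by (rule prob_space_distrD[rotated]) measurable
  then show thesis using that sets distr int by blast
qed

text \<open>A point of cell i goes to \<open>c i\<close> with probability \<open>w i\<close> divided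
  by the mass of the cell, and to \<open>z\<close> otherwise. The first kind of move costs at most
  \<kappa> by the size of the cells, the second at most \<kappa> by the moment bound; hence
  \<open>2 * \<kappa>\<close>. The resulting measure depends on \<open>w\<close>, \<open>c\<close>
  and \<open>z\<close> but not on \<alpha>, so all members of the class share it.\<close>

lemma coupled_with_atoms:
  fixes \<alpha> :: "'a::polish_space measure"
  assumes j: "j \<in> borel \<rightarrow>\<^sub>M count_space UNIV" and \<kappa>: "0 \<le> \<kappa>"
    and c: "\<And>y. dist y (c (j y)) powr p \<le> \<kappa>"
    and l: "\<And>i. 0 \<le> l i" "\<And>y. l (j y) \<le> dist z y powr p"
    and w: "\<And>i. 0 \<le> w i" "(\<Sum>i. ennreal (w i * l i)) < \<infinity>"
    and r: "2 * \<kappa> \<le> r powr p"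
    and \<alpha>: "\<alpha> \<in> mass_class p z j l \<kappa> w"
  obtains \<beta> where "sets \<beta> = sets borel" "coupled_within p r \<alpha> \<beta>"
    "\<And>E. E \<in> sets borel \<Longrightarrow> emeasure \<beta> E =
       (\<Sum>i. ennreal (w i) * indicator E (c i)) + (1 - (\<Sum>i. ennreal (w i))) * indicator E z"
proof -
  have prob_\<alpha>: "prob_space \<alpha>" and sets_\<alpha>[measurable_cong]: "sets \<alpha> = sets borel"
    and mass: "\<And>i. ennreal (w i) \<le> emeasure \<alpha> (j -` {i})"
    and moment: "(\<integral>\<^sup>+y. ennreal (dist z y powr p) \<partial>\<alpha>) \<le> ennreal \<kappa> + (\<Sum>i. ennreal (w i * l i))"
    using \<alpha> by (auto simp: mass_class_def)
  interpret prob_space \<alpha> by fact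
  have space_\<alpha>[simp]: "space \<alpha> = UNIV" using sets_eq_imp_space_eq[OF sets_\<alpha>] by simp
  note j[measurable]
  have j_\<alpha>: "j \<in> \<alpha> \<rightarrow>\<^sub>M count_space UNIV" by measurable
  define a where "a i = measure \<alpha> (j -` {i})" for i
  have a: "emeasure \<alpha> (j -` {i}) = ennreal (a i)" for i
    by (simp add: a_def emeasure_eq_measure)
  have wa: "w i \<le> a i" for i
    using mass[of i] by (simp add: a a_def)
  \<comment> \<open>On a null cell the bound \<open>wa\<close> forces \<open>w i = 0\<close>, so the
    default 0 still satisfies \<open>t i * a i = w i\<close>.\<close>
  define t where "t i = (if a i = 0 then 0 else w i / a i)" for i
  have a_nonneg: "0 \<le> a i" for i by (simp add: a_def)
  have t: "0 \<le> t i" "t i \<le> 1" "t i * a i = w i" for i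
    using w(1)[of i] wa[of i] a_nonneg[of i] by (auto simp: t_def divide_le_eq)
  have cells: "(\<integral>\<^sup>+y. f (j y) \<partial>\<alpha>) = (\<Sum>i. f i * ennreal (a i))" for f
    using nn_integral_nat_valued[OF j_\<alpha>, of f] by (simp add: a)
  obtain \<Omega> where \<Omega>: "prob_space \<Omega>"
    and [measurable_cong]: "sets \<Omega> = sets (\<alpha> \<Otimes>\<^sub>M count_space (UNIV :: bool set))"
    and \<Omega>1: "distr \<Omega> \<alpha> fst = \<alpha>"
    and int: "\<And>F. F \<in> borel_measurable (\<alpha> \<Otimes>\<^sub>M count_space UNIV) \<Longrightarrow> (\<integral>\<^sup>+\<omega>. F \<omega> \<partial>\<Omega>)
      = (\<integral>\<^sup>+y. ennreal (t (j y)) * F (y, True) + ennreal (1 - t (j y)) * F (y, False) \<partial>\<alpha>)"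
    by (rule two_point_randomisation[OF prob_\<alpha>, of "\<lambda>y. t (j y)"]) (use t in auto)
  define S where "S \<omega> = (if snd \<omega> then c (j (fst \<omega>)) else z)" for \<omega>
  have S[measurable]: "S \<in> \<Omega> \<rightarrow>\<^sub>M borel" unfolding S_def by measurable
  have [measurable]: "fst \<in> \<Omega> \<rightarrow>\<^sub>M borel" by measurable
  have S'[measurable]: "S \<in> \<alpha> \<Otimes>\<^sub>M count_space UNIV \<rightarrow>\<^sub>M borel" unfolding S_def by measurable
  define T where "T = (\<Sum>i. ennreal (w i * l i))"
  \<comment> \<open>The cost of the surplus sent to \<open>z\<close>. The moment of \<alpha> is X
    plus the share of the guaranteed masses; that share is at least T because \<open>l\<close>
    bounds the integrand from below on each cell. Comparing with the bound \<kappa> + T and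
    cancelling the finite T leaves X at most \<kappa>.\<close>
  define X where "X = (\<integral>\<^sup>+y. ennreal (1 - t (j y)) * ennreal (dist z y powr p) \<partial>\<alpha>)"
  have "X \<le> ennreal \<kappa>"
  proof -
    have "ennreal (w i * l i) = ennreal (t i * l i) * ennreal (a i)" for i
      unfolding t(3)[of i, symmetric] using t(1)[of i] l(1)[of i] a_nonneg[of i]
      by (simp flip: ennreal_mult add: mult_ac)
    then have "T = (\<integral>\<^sup>+y. ennreal (t (j y) * l (j y)) \<partial>\<alpha>)"
      unfolding T_def by (subst cells[of "\<lambda>i. ennreal (t i * l i)"]) simp
    also have "\<dots> \<le> (\<integral>\<^sup>+y. ennreal (t (j y)) * ennreal (dist z y powr p) \<partial>\<alpha>)"
      using t l by (intro nn_integral_mono) (auto simp flip: ennreal_mult intro!: ennreal_leI mult_left_mono)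
    finally have "X + T \<le> X + (\<integral>\<^sup>+y. ennreal (t (j y)) * ennreal (dist z y powr p) \<partial>\<alpha>)"
      by (rule add_left_mono)
    also have "\<dots> = (\<integral>\<^sup>+y. ennreal (dist z y powr p) \<partial>\<alpha>)"
      unfolding X_def using t
      by (subst nn_integral_add[symmetric]) (auto simp flip: distrib_right ennreal_plus intro!: nn_integral_cong)
    also have "\<dots> \<le> ennreal \<kappa> + T" using moment by (simp add: T_def)
    finally show ?thesis using w(2) by (auto simp: T_def ennreal_add_left_cancel_le add.commute[of _ "suminf _"])
  qed
  have "coupled_within p r (distr \<Omega> borel fst) (distr \<Omega> borel S)"
  proof (rule coupled_within_distr[OF \<Omega>])
    have "(\<integral>\<^sup>+\<omega>. ennreal (dist (fst \<omega>) (S \<omega>) powr p) \<partial>\<Omega>)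
        = (\<integral>\<^sup>+y. ennreal (t (j y)) * ennreal (dist y (c (j y)) powr p)
              + ennreal (1 - t (j y)) * ennreal (dist z y powr p) \<partial>\<alpha>)"
      by (subst int) (auto simp: S_def dist_commute)
    also have "\<dots> \<le> (\<integral>\<^sup>+y. ennreal \<kappa> + ennreal (1 - t (j y)) * ennreal (dist z y powr p) \<partial>\<alpha>)"
    proof (intro nn_integral_mono add_right_mono)
      fix y
      have "t (j y) * dist y (c (j y)) powr p \<le> 1 * \<kappa>"
        using t c \<kappa> by (intro mult_mono) auto
      then show "ennreal (t (j y)) * ennreal (dist y (c (j y)) powr p) \<le> ennreal \<kappa>"
        using t by (auto simp flip: ennreal_mult intro!: ennreal_leI)
    qed
    also have "\<dots> = ennreal \<kappa> + X"
      unfolding X_def by (subst nn_integral_add) (auto simp: emeasure_space_1[simplified])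
    also have "\<dots> \<le> ennreal \<kappa> + ennreal \<kappa>" using \<open>X \<le> ennreal \<kappa>\<close> by (rule add_left_mono)
    also have "\<dots> \<le> ennreal (r powr p)" using \<kappa> r by (simp add: ennreal_leI flip: ennreal_plus)
    finally show "(\<integral>\<^sup>+\<omega>. ennreal (dist (fst \<omega>) (S \<omega>) powr p) \<partial>\<Omega>) \<le> ennreal (r powr p)" .
  qed measurable
  moreover have "distr \<Omega> borel fst = \<alpha>" using \<Omega>1 by (metis distr_cong sets_\<alpha>)
  moreover have "emeasure (distr \<Omega> borel S) E
      = (\<Sum>i. ennreal (w i) * indicator E (c i)) + (1 - (\<Sum>i. ennreal (w i))) * indicator E z"
    if [measurable]: "E \<in> sets borel" for E
  proof -
    have "ennreal (1 - t i) * ennreal (a i) + ennreal (w i) = ennreal (a i)" for i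
      unfolding t(3)[of i, symmetric] using t(1,2)[of i] a_nonneg[of i]
      by (simp flip: ennreal_mult ennreal_plus distrib_right)
    then have "(\<Sum>i. ennreal (1 - t i) * ennreal (a i)) + (\<Sum>i. ennreal (w i)) = (\<Sum>i. 1 * ennreal (a i))"
      by (subst suminf_add) simp_all
    also have "\<dots> = 1" using cells[of "\<lambda>_. 1"] by (simp add: emeasure_space_1[simplified])
    finally have rest: "(\<Sum>i. ennreal (1 - t i) * ennreal (a i)) = 1 - (\<Sum>i. ennreal (w i))"
      by (metis ennreal_add_diff_cancel_right ennreal_add_eq_top ennreal_one_neq_top)
    have "emeasure (distr \<Omega> borel S) E = (\<integral>\<^sup>+x. indicator E x \<partial>distr \<Omega> borel S)" by simp
    also have "\<dots> = (\<integral>\<^sup>+\<omega>. indicator E (S \<omega>) \<partial>\<Omega>)" by (subst nn_integral_distr) auto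
    also have "\<dots> = (\<integral>\<^sup>+y. ennreal (t (j y)) * indicator E (c (j y))
        + ennreal (1 - t (j y)) * indicator E z \<partial>\<alpha>)"
      by (subst int) (auto simp: S_def)
    also have "\<dots> = (\<Sum>i. (ennreal (t i) * indicator E (c i)
        + ennreal (1 - t i) * indicator E z) * ennreal (a i))"
      by (rule cells)
    also have "\<dots> = (\<Sum>i. ennreal (w i) * indicator E (c i)
        + (ennreal (1 - t i) * ennreal (a i)) * indicator E z)"
    proof (rule suminf_cong)
      fix i
      have "ennreal (w i) = ennreal (t i) * ennreal (a i)"
        unfolding t(3)[of i, symmetric] using t(1) a_nonneg by (rule ennreal_mult)
      then show "(ennreal (t i) * indicator E (c i) + ennreal (1 - t i) * indicator E z) * ennreal (a i)
          = ennreal (w i) * indicator E (c i) + (ennreal (1 - t i) * ennreal (a i)) * indicator E z"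
        by (simp add: indicator_def distrib_right)
    qed
    also have "\<dots> = (\<Sum>i. ennreal (w i) * indicator E (c i))
        + (\<Sum>i. ennreal (1 - t i) * ennreal (a i)) * indicator E z"
      by (subst suminf_add[symmetric]) (auto simp: ennreal_suminf_multc)
    finally show ?thesis by (simp add: rest)
  qed
  ultimately show thesis using that[of "distr \<Omega> borel S"] by auto
qed

text \<open>Two legs of length \<open>r\<close> through the common atomic measure: the formula for
  its mass on Borel sets determines it, so the measures obtained from \<alpha> and \<alpha>'
  coincide.\<close>

lemma Wass_mass_class:
  fixes \<alpha> \<alpha>' :: "'a::polish_space measure"
  assumes p: "p \<ge> 1" and j: "j \<in> borel \<rightarrow>\<^sub>M count_space UNIV" and \<kappa>: "0 \<le> \<kappa>"
    and c: "\<And>y. dist y (c (j y)) powr p \<le> \<kappa>"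
    and l: "\<And>i. 0 \<le> l i" "\<And>y. l (j y) \<le> dist z y powr p"
    and w: "\<And>i. 0 \<le> w i" "(\<Sum>i. ennreal (w i * l i)) < \<infinity>"
    and r: "2 * \<kappa> \<le> r powr p" "0 \<le> r"
    and \<alpha>: "\<alpha> \<in> mass_class p z j l \<kappa> w" "\<alpha>' \<in> mass_class p z j l \<kappa> w"
  shows "Wass p \<alpha> \<alpha>' \<le> ennreal (2 * r)"
proof -
  obtain \<beta> where \<beta>: "sets \<beta> = sets borel" "coupled_within p r \<alpha> \<beta>"
    "\<And>E. E \<in> sets borel \<Longrightarrow> emeasure \<beta> E =
       (\<Sum>i. ennreal (w i) * indicator E (c i)) + (1 - (\<Sum>i. ennreal (w i))) * indicator E z"
    using coupled_with_atoms[OF j \<kappa> c l w r(1) \<alpha>(1)] by blast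
  obtain \<beta>' where \<beta>': "sets \<beta>' = sets borel" "coupled_within p r \<alpha>' \<beta>'"
    "\<And>E. E \<in> sets borel \<Longrightarrow> emeasure \<beta>' E =
       (\<Sum>i. ennreal (w i) * indicator E (c i)) + (1 - (\<Sum>i. ennreal (w i))) * indicator E z"
    using coupled_with_atoms[OF j \<kappa> c l w r(1) \<alpha>(2)] by blast
  have [simp]: "\<beta>' = \<beta>"
    by (rule measure_eqI) (use \<beta>(1,3) \<beta>'(1,3) in auto)
  have sets: "sets \<alpha> = sets borel" "sets \<alpha>' = sets borel" using \<alpha> by (auto simp: mass_class_def)
  have "Wass p \<alpha> \<alpha>' \<le> Wass p \<alpha> \<beta> + Wass p \<beta> \<alpha>'"
    using sets \<beta>(1) by (intro Wass_triangle p)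
  also have "\<dots> \<le> ennreal r + ennreal r"
    using \<beta>(2) coupled_within_sym[OF \<beta>'(2) sets(2) \<beta>'(1)] p r(2)
    by (intro add_mono Wass_le_of_coupled_within) auto
  also have "\<dots> = ennreal (2 * r)" using r(2) by (simp flip: ennreal_plus)
  finally show ?thesis .
qed

section \<open>A countable cover of the measures with finite moment\<close>

text \<open>Finite lists of rationals form a countable type and so can index the pieces; clipping at
  0 makes every list a legitimate weight vector.\<close>

definition rat_weights :: "rat list \<Rightarrow> nat \<Rightarrow> real" where
  "rat_weights qs i = (if i < length qs then max 0 (of_rat (qs ! i)) else 0)"

text \<open>The true cell masses are truncated and rounded down, which preserves the mass condition.
  The tolerance \<kappa> is spent in thirds: on the variation of the integrand inside a cell, on the
  tail of the series, and on the rounding.\<close>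

lemma ex_rat_weights_mass_class:
  fixes \<alpha> :: "'a::polish_space measure"
  assumes prob: "prob_space \<alpha>" and sets: "sets \<alpha> = sets borel"
    and moment: "(\<integral>\<^sup>+y. ennreal (dist z y powr p) \<partial>\<alpha>) < \<infinity>"
    and j: "j \<in> borel \<rightarrow>\<^sub>M count_space UNIV" and \<kappa>: "0 < \<kappa>"
    and l: "\<And>i. 0 \<le> l i" "\<And>y. l (j y) \<le> dist z y powr p" "\<And>y. dist z y powr p \<le> l (j y) + \<kappa> / 3"
  shows "\<exists>qs. \<alpha> \<in> mass_class p z j l \<kappa> (rat_weights qs)"
proof -
  interpret prob_space \<alpha> by fact
  note sets[measurable_cong] j[measurable]
  have space_\<alpha>[simp]: "space \<alpha> = UNIV" using sets_eq_imp_space_eq[OF sets] by simp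
  have j_\<alpha>: "j \<in> \<alpha> \<rightarrow>\<^sub>M count_space UNIV" by measurable
  define a where "a i = measure \<alpha> (j -` {i})" for i
  have a: "emeasure \<alpha> (j -` {i}) = ennreal (a i)" "0 \<le> a i" for i
    by (simp_all add: a_def emeasure_eq_measure)
  have al: "(\<integral>\<^sup>+y. ennreal (l (j y)) \<partial>\<alpha>) = (\<Sum>i. ennreal (a i * l i))"
    using nn_integral_nat_valued[OF j_\<alpha>, of "\<lambda>i. ennreal (l i)"] l(1) a(2)
    by (simp add: a(1) ennreal_mult mult.commute)
  have "(\<Sum>i. ennreal (a i * l i)) \<le> (\<integral>\<^sup>+y. ennreal (dist z y powr p) \<partial>\<alpha>)"
    unfolding al[symmetric] using l by (intro nn_integral_mono ennreal_leI)
  then have fin: "(\<Sum>i. ennreal (a i * l i)) \<noteq> top"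
    using moment by (auto simp: top_unique)
  have al_nonneg: "0 \<le> a i * l i" for i using a(2) l(1) by simp
  have summ: "summable (\<lambda>i. a i * l i)"
    using summable_suminf_not_top[OF al_nonneg fin] .
  have "\<forall>\<^sub>F n in sequentially. (\<Sum>i. a i * l i) - \<kappa> / 3 < (\<Sum>i<n. a i * l i)"
    using summable_LIMSEQ[OF summ] \<kappa> by (intro order_tendstoD) auto
  then obtain N where N: "(\<Sum>i. a i * l i) - \<kappa> / 3 < (\<Sum>i<N. a i * l i)"
    using eventually_sequentially by auto
  \<comment> \<open>Each of the \<open>N\<close> retained cells may lose \<delta> of moment, in
    total at most \<open>\<kappa> / 3\<close>. A weight is therefore rounded by at most
    \<open>\<delta> / (l i + 1)\<close>; both added ones keep denominators positive.\<close>
  define \<delta> where "\<delta> = \<kappa> / (3 * (real N + 1))"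
  have \<delta>: "0 < \<delta>" "real N * \<delta> \<le> \<kappa> / 3" using \<kappa> by (auto simp: \<delta>_def field_simps)
  have "\<exists>q. a i - \<delta> / (l i + 1) < of_rat q \<and> of_rat q < a i" for i
    using \<delta>(1) l(1)[of i] by (intro of_rat_dense) (auto simp: add_nonneg_pos)
  then obtain q where q: "\<And>i. a i - \<delta> / (l i + 1) < of_rat (q i)" "\<And>i. of_rat (q i) < a i"
    by metis
  define w where "w = rat_weights (map q [0..<N])"
  have w: "w i = (if i < N then max 0 (of_rat (q i)) else 0)" for i
    by (simp add: w_def rat_weights_def)
  have w_le: "0 \<le> w i" "w i \<le> a i" for i using q(2)[of i] a(2)[of i] by (auto simp: w)
  have "a i * l i - \<delta> \<le> w i * l i" if "i < N" for i
  proof -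
    have "a i - w i \<le> \<delta> / (l i + 1)" using q(1)[of i] that by (auto simp: w)
    then have "(a i - w i) * (l i + 1) \<le> \<delta>" using l(1)[of i] by (simp add: pos_le_divide_eq add_nonneg_pos)
    moreover have "(a i - w i) * l i \<le> (a i - w i) * (l i + 1)"
      using w_le[of i] by (intro mult_left_mono) auto
    ultimately show ?thesis by (simp add: algebra_simps)
  qed
  then have "(\<Sum>i<N. a i * l i - \<delta>) \<le> (\<Sum>i<N. w i * l i)" by (intro sum_mono) auto
  then have sum_w: "(\<Sum>i. a i * l i) \<le> (\<Sum>i<N. w i * l i) + \<kappa> / 3 + \<kappa> / 3"
    using N \<delta>(2) by (simp add: sum_subtractf)
  have "(\<integral>\<^sup>+y. ennreal (dist z y powr p) \<partial>\<alpha>) \<le> (\<integral>\<^sup>+y. ennreal (l (j y)) + ennreal (\<kappa> / 3) \<partial>\<alpha>)"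
    using l \<kappa> by (intro nn_integral_mono) (simp flip: ennreal_plus add: ennreal_leI)
  also have "\<dots> = ennreal (\<Sum>i. a i * l i) + ennreal (\<kappa> / 3)"
    using suminf_ennreal2[OF al_nonneg summ]
    by (subst nn_integral_add) (auto simp: al emeasure_space_1[simplified])
  also have "\<dots> = ennreal ((\<Sum>i. a i * l i) + \<kappa> / 3)"
    using \<kappa> suminf_nonneg[OF summ al_nonneg] by simp
  also have "\<dots> \<le> ennreal (\<kappa> + (\<Sum>i<N. w i * l i))" using sum_w by (intro ennreal_leI) simp
  also have "\<dots> = ennreal \<kappa> + (\<Sum>i<N. ennreal (w i * l i))"
    using \<kappa> w_le(1) l(1) by (simp add: sum_nonneg sum_ennreal)
  also have "\<dots> \<le> ennreal \<kappa> + (\<Sum>i. ennreal (w i * l i))"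
    by (intro add_left_mono sum_le_suminf) auto
  finally show ?thesis
    using prob sets a w_le(2) unfolding w_def mass_class_def by (auto intro!: exI ennreal_leI)
qed

text \<open>Moving the base point adds the constant \<open>dist z z'\<close> to the distance, which
  Minkowski absorbs. The two added ones make the radii positive, as that inequality
  requires.\<close>

lemma Pr_moment_finite:
  assumes p: "p \<ge> 1" and \<mu>: "\<mu> \<in> Pr p"
  obtains r where "0 < r" "(\<integral>\<^sup>+y. ennreal (dist z y powr p) \<partial>\<mu>) \<le> ennreal (r powr p)"
proof -
  have prob: "prob_space \<mu>" and [measurable_cong]: "sets \<mu> = sets borel" using \<mu> by (auto simp: Pr_def)
  interpret prob_space \<mu> by fact
  obtain z' where "(\<integral>\<^sup>+y. ennreal (dist z' y powr p) \<partial>\<mu>) < \<infinity>" using \<mu> by (auto simp: Pr_def)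
  then obtain s where s: "0 \<le> s" "(\<integral>\<^sup>+y. ennreal (dist z' y powr p) \<partial>\<mu>) = ennreal s"
    by (metis ennreal_cases infinity_ennreal_def less_irrefl)
  define a where "a = (s + 1) powr (1 / p)"
  define b where "b = dist z z' + 1"
  have pos: "0 < a" "0 < b" using s(1) by (auto simp: a_def b_def add_nonneg_pos)
  have le: "dist z y \<le> dist z' y + b" for y
    using dist_triangle[of z y z'] by (simp add: b_def)
  have "a powr p = s + 1" using p s(1) by (simp add: a_def powr_powr)
  then have "(\<integral>\<^sup>+y. ennreal (dist z' y powr p) \<partial>\<mu>) \<le> ennreal (a powr p)"
    by (simp add: s(2) ennreal_leI)
  then have "(\<integral>\<^sup>+y. ennreal ((dist z' y + b) powr p) \<partial>\<mu>) \<le> ennreal ((a + b) powr p)"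
    using pos p by (intro nn_integral_Minkowski) (auto simp: emeasure_space_1)
  moreover have "(\<integral>\<^sup>+y. ennreal (dist z y powr p) \<partial>\<mu>) \<le> (\<integral>\<^sup>+y. ennreal ((dist z' y + b) powr p) \<partial>\<mu>)"
    using p le by (intro nn_integral_mono ennreal_leI powr_mono2) auto
  ultimately show thesis using that[of "a + b"] pos by (auto intro: order_trans)
qed

text \<open>A countable partition on whose pieces the kernel is nearly constant, even after averaging
  over any law carried by the piece. This replaces a measurable selection of couplings.\<close>

lemma kernel_partition:
  fixes P :: "'b::topological_space \<Rightarrow> 'a::polish_space measure"
  assumes p: "p \<ge> 1" and P: "P \<in> borel \<rightarrow>\<^sub>M prob_algebra borel"
    and Pr: "\<And>x. P x \<in> Pr p" and \<epsilon>: "\<epsilon> > 0"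
  obtains k :: "'b \<Rightarrow> nat" where "k \<in> borel \<rightarrow>\<^sub>M count_space UNIV"
    "\<And>M x. prob_space M \<Longrightarrow> sets M = sets borel \<Longrightarrow> AE y in M. k y = k x \<Longrightarrow>
       Wass p (M \<bind> P) (P x) \<le> ennreal \<epsilon>"
proof -
  \<comment> \<open>Two members of a class are within \<open>2 * r\<close>, and
    \<open>2 * \<kappa> \<le> r powr p\<close> is the transport budget of one leg.\<close>
  define r where "r = \<epsilon> / 2"
  define \<kappa> where "\<kappa> = r powr p / 2"
  have r: "0 < r" and \<kappa>: "0 < \<kappa>" "2 * \<kappa> \<le> r powr p" using \<epsilon> by (auto simp: r_def \<kappa>_def)
  define z :: 'a where "z = undefined"
  define e where "e = \<kappa> powr (1 / p)"
  have "e > 0" using \<kappa> by (simp add: e_def)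
  then obtain s :: "nat \<Rightarrow> 'a" and j0 :: "'a \<Rightarrow> nat" where
    j0[measurable]: "j0 \<in> borel \<rightarrow>\<^sub>M count_space UNIV" and s: "\<And>y. dist y (s (j0 y)) < e"
    using ex_small_cells by metis
  \<comment> \<open>Level sets of the moment integrand in steps of \<open>\<kappa> / 3\<close>. The
    cells below refine them by the small cells of \<open>j0\<close>: one component bounds the move
    to the centre, the other supplies the lower bound \<open>l\<close>.\<close>
  define h where "h y = nat \<lfloor>dist z y powr p / (\<kappa> / 3)\<rfloor>" for y
  have [measurable]: "h \<in> borel \<rightarrow>\<^sub>M count_space UNIV" unfolding h_def by measurable
  define j where "j y = prod_encode (j0 y, h y)" for y
  have j: "j \<in> borel \<rightarrow>\<^sub>M count_space UNIV" unfolding j_def by measurable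
  define c where "c i = s (fst (prod_decode i))" for i
  define l where "l i = \<kappa> / 3 * real (snd (prod_decode i))" for i
  have c: "dist y (c (j y)) powr p \<le> \<kappa>" for y
  proof -
    have "dist y (c (j y)) powr p \<le> e powr p"
      using p s[of y] by (intro powr_mono2) (auto simp: c_def j_def less_imp_le)
    then show ?thesis using p \<kappa> by (simp add: e_def powr_powr)
  qed
  have h: "real (h y) \<le> dist z y powr p / (\<kappa> / 3)" "dist z y powr p / (\<kappa> / 3) \<le> real (h y) + 1" for y
  proof -
    have "0 \<le> dist z y powr p / (\<kappa> / 3)" using \<kappa> by simp
    then show "real (h y) \<le> dist z y powr p / (\<kappa> / 3)" "dist z y powr p / (\<kappa> / 3) \<le> real (h y) + 1"
      unfolding h_def by linarith+
  qed
  have l: "0 \<le> l i" "l (j y) \<le> dist z y powr p" "dist z y powr p \<le> l (j y) + \<kappa> / 3" for i y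
    using h[of y] \<kappa> by (auto simp: l_def j_def field_simps)
  define \<C> where "\<C> n = mass_class p z j l \<kappa> (rat_weights (from_nat n))" for n :: nat
  define k where "k x = (LEAST n. P x \<in> \<C> n)" for x
  have k_mem: "P x \<in> \<C> (k x)" for x
  proof -
    have "prob_space (P x)" "sets (P x) = sets borel" using Pr[of x] by (auto simp: Pr_def)
    moreover obtain R where "(\<integral>\<^sup>+y. ennreal (dist z y powr p) \<partial>P x) \<le> ennreal (R powr p)"
      using Pr_moment_finite[OF p Pr[of x]] .
    then have "(\<integral>\<^sup>+y. ennreal (dist z y powr p) \<partial>P x) < \<infinity>" by (rule order.strict_trans1) simp
    ultimately obtain qs where "P x \<in> mass_class p z j l \<kappa> (rat_weights qs)"
      using ex_rat_weights_mass_class[OF _ _ _ j \<kappa>(1) l] by blast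
    then have "P x \<in> \<C> (to_nat qs)" by (simp add: \<C>_def)
    then show ?thesis unfolding k_def by (rule LeastI)
  qed
  show thesis
  proof (rule that)
    show "k \<in> borel \<rightarrow>\<^sub>M count_space UNIV"
      unfolding k_def \<C>_def using mass_class_measurable[OF P j] by (intro measurable_Least)
    fix M x assume M: "prob_space M" "sets M = sets borel" and AE: "AE y in M. k y = k x"
    have "AE y in M. P y \<in> \<C> (k x)" using AE by eventually_elim (metis k_mem)
    then have "M \<bind> P \<in> \<C> (k x)"
      unfolding \<C>_def by (rule bind_mass_class[OF P M j])
    moreover have "(\<Sum>i. ennreal (rat_weights qs i * l i)) < \<infinity>" for qs
      by (subst suminf_finite[of "{..<length qs}"]) (auto simp: rat_weights_def)
    ultimately have "Wass p (M \<bind> P) (P x) \<le> ennreal (2 * r)"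
      using k_mem[of x] \<kappa> r unfolding \<C>_def
      by (intro Wass_mass_class[OF p j _ c l(1,2)]) (auto simp: rat_weights_def)
    then show "Wass p (M \<bind> P) (P x) \<le> ennreal \<epsilon>" by (simp add: r_def)
  qed
qed

subsection \<open>Mixtures of couplings\<close>

text \<open>Marginals and integrals commute with \<open>bind\<close>, so mixing couplings yields a
  coupling of the mixtures at the average cost. In the application \<open>H\<close> factors through
  a countable index.\<close>

lemma coupled_within_bind:
  fixes K K' :: "'b \<Rightarrow> 'a::polish_space measure"
  assumes M: "prob_space M"
    and K: "K \<in> M \<rightarrow>\<^sub>M prob_algebra borel" and K': "K' \<in> M \<rightarrow>\<^sub>M prob_algebra borel"
    and H: "H \<in> M \<rightarrow>\<^sub>M prob_algebra borel" "\<And>x. x \<in> space M \<Longrightarrow> H x \<in> couplings (K x) (K' x)"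
    and le: "(\<integral>\<^sup>+x. \<integral>\<^sup>+(y, y'). ennreal (dist y y' powr p) \<partial>H x \<partial>M) \<le> ennreal (r powr p)"
  shows "coupled_within p r (M \<bind> K) (M \<bind> K')"
proof -
  have M_in: "M \<in> space (prob_algebra M)" using M by (simp add: space_prob_algebra)
  have sets_K: "sets (K x) = sets borel" "sets (K' x) = sets borel" if "x \<in> space M" for x
    using measurable_space[OF K that] measurable_space[OF K' that] by (auto simp: space_prob_algebra)
  have marg: "distr (H x) borel fst = K x" "distr (H x) borel snd = K' x" if "x \<in> space M" for x
    using H(2)[OF that] couplings_iff[OF sets_K[OF that]] by auto
  have fs: "fst \<in> borel \<rightarrow>\<^sub>M (borel :: 'a measure)" "snd \<in> borel \<rightarrow>\<^sub>M (borel :: 'a measure)"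
    by (auto intro!: borel_measurable_continuous_onI continuous_intros)
  have cost: "(\<lambda>(y :: 'a, y'). ennreal (dist y y' powr p)) \<in> borel_measurable borel"
    unfolding borel_prod[symmetric] by measurable
  note H' = measurable_prob_algebraD[OF H(1)]
  have ne: "space M \<noteq> {}" using M by (rule prob_space.not_empty)
  have "distr (M \<bind> H) borel fst = M \<bind> K" "distr (M \<bind> H) borel snd = M \<bind> K'"
    unfolding distr_bind[OF H' ne fs(1)] distr_bind[OF H' ne fs(2)]
    using marg by (intro bind_cong refl; simp)+
  moreover have "M \<bind> H \<in> space (prob_algebra borel)"
    using prob_space_bind'[OF M_in H(1)] sets_bind'[OF M_in H(1)] by (simp add: space_prob_algebra)
  ultimately have "M \<bind> H \<in> couplings (M \<bind> K) (M \<bind> K')"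
    by (subst couplings_iff) (auto simp: sets_bind'[OF M_in K] sets_bind'[OF M_in K'])
  moreover have "(\<integral>\<^sup>+(y, y'). ennreal (dist y y' powr p) \<partial>(M \<bind> H)) \<le> ennreal (r powr p)"
    using le by (subst nn_integral_bind[OF cost H'])
  ultimately show ?thesis by (auto simp: coupled_within_def)
qed

lemma pair_measure_coupling:
  assumes "prob_space \<mu>" "prob_space \<nu>"
  shows "\<mu> \<Otimes>\<^sub>M \<nu> \<in> couplings \<mu> \<nu>"
  using assms prob_space_pair[OF assms] prob_space.distr_pair_fst[of \<nu> \<mu>] distr_pair_snd[of \<mu> \<nu>]
  by (simp add: couplings_def)

text \<open>One coupling serves every bound \<open>w\<close>, so it can be chosen for all index
  pairs before the distances of the underlying points are known. At infinite distance the cost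
  condition is void and the product measure serves.\<close>

lemma ex_nearly_optimal_coupling:
  fixes \<mu> \<nu> :: "'a::polish_space measure"
  assumes p: "p \<ge> 1" and prob: "prob_space \<mu>" "prob_space \<nu>" and \<epsilon>: "\<epsilon> > 0"
  shows "\<exists>\<eta>\<in>couplings \<mu> \<nu>. \<forall>w\<ge>0. Wass p \<mu> \<nu> \<le> ennreal w \<longrightarrow>
    (\<integral>\<^sup>+(x, y). ennreal (dist x y powr p) \<partial>\<eta>) \<le> ennreal ((w + \<epsilon>) powr p)"
proof (cases "Wass p \<mu> \<nu> = \<infinity>")
  case True
  then show ?thesis using pair_measure_coupling[OF prob] by (auto simp: top_unique)
next
  case False
  then obtain v where v: "Wass p \<mu> \<nu> = ennreal v" "0 \<le> v"
    by (metis ennreal_cases infinity_ennreal_def)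
  then have "coupled_within p (v + \<epsilon>) \<mu> \<nu>"
    using \<epsilon> p by (auto intro!: coupled_within_of_Wass_less simp: ennreal_less_iff)
  then obtain \<eta> where \<eta>: "\<eta> \<in> couplings \<mu> \<nu>"
    and cost: "(\<integral>\<^sup>+(x, y). ennreal (dist x y powr p) \<partial>\<eta>) \<le> ennreal ((v + \<epsilon>) powr p)"
    by (auto simp: coupled_within_def)
  have "ennreal ((v + \<epsilon>) powr p) \<le> ennreal ((w + \<epsilon>) powr p)" if "0 \<le> w" "Wass p \<mu> \<nu> \<le> ennreal w" for w
    using that v \<epsilon> p by (intro ennreal_leI powr_mono2) auto
  then show ?thesis using \<eta> cost by (meson order_trans)
qed

text \<open>Replacing the kernel by its averages over the fibres of \<open>f\<close> leaves the
  image of \<open>M\<close> unchanged: associativity of \<open>bind\<close> and the law of total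
  probability.\<close>

lemma (in prob_space) bind_cond_on_kernel:
  assumes f: "f \<in> M \<rightarrow>\<^sub>M count_space UNIV" and P: "P \<in> M \<rightarrow>\<^sub>M prob_algebra N"
  shows "M \<bind> (\<lambda>x. cond_on M f (f x) \<bind> P) = M \<bind> P"
proof -
  have "(\<lambda>x. cond_on M f (f x)) \<in> M \<rightarrow>\<^sub>M subprob_algebra M"
    using measurable_prob_algebraD[OF measurable_compose[OF f measurable_cond_on]] .
  from bind_assoc[OF this measurable_prob_algebraD[OF P]] show ?thesis
    by (simp add: bind_cond_on[OF f])
qed

section \<open>Finite moments of the image and the contraction estimate\<close>

text \<open>Through a coupling with \<open>P z\<close>, the moment of \<open>P x\<close> around
  \<open>z\<close> is at most the p-th power of a function affine in \<open>dist z x\<close>, and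
  such a function has finite p-th moment under \<mu>. Minkowski is used once under the coupling and
  once under \<mu>.\<close>

lemma bind_in_Pr:
  fixes P :: "'a::polish_space \<Rightarrow> 'a measure"
  assumes p: "p \<ge> 1" and C: "C > 0" and P: "P \<in> borel \<rightarrow>\<^sub>M prob_algebra borel"
    and Pr: "\<And>x. P x \<in> Pr p" and lip: "\<And>x y. Wass p (P x) (P y) \<le> ennreal (C * dist x y)"
    and \<mu>: "\<mu> \<in> Pr p"
  shows "\<mu> \<bind> P \<in> Pr p"
proof -
  have \<mu>_prob: "prob_space \<mu>" and \<mu>_sets[measurable_cong]: "sets \<mu> = sets borel" using \<mu> by (auto simp: Pr_def)
  interpret prob_space \<mu> by fact
  have \<mu>_in: "\<mu> \<in> space (prob_algebra borel)" using \<mu>_prob \<mu>_sets by (simp add: space_prob_algebra)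
  have P': "P \<in> \<mu> \<rightarrow>\<^sub>M subprob_algebra borel"
    using measurable_prob_algebraD[OF P] \<mu>_sets by (simp cong: measurable_cong_sets)
  have sets_P: "sets (P x) = sets borel" for x using Pr[of x] by (simp add: Pr_def)
  define z :: 'a where "z = undefined"
  obtain a where a: "0 < a" "(\<integral>\<^sup>+y. ennreal (dist z y powr p) \<partial>P z) \<le> ennreal (a powr p)"
    using Pr_moment_finite[OF p Pr] .
  obtain b where b: "0 < b" "(\<integral>\<^sup>+y. ennreal (dist z y powr p) \<partial>\<mu>) \<le> ennreal (b powr p)"
    using Pr_moment_finite[OF p \<mu>] .
  have inner: "(\<integral>\<^sup>+y. ennreal (dist z y powr p) \<partial>P x) \<le> ennreal ((C * dist z x + (a + 1)) powr p)" for x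
  proof -
    \<comment> \<open>The added 1 makes the Lipschitz bound strict, so that a coupling of this cost
      exists.\<close>
    have "Wass p (P z) (P x) < ennreal (C * dist z x + 1)"
      using C by (intro order.strict_trans1[OF lip]) (auto simp: ennreal_less_iff)
    then have "coupled_within p (C * dist z x + 1) (P z) (P x)"
      using C by (intro coupled_within_of_Wass_less p) (auto intro: add_nonneg_pos)
    then obtain \<eta> where \<eta>: "prob_space \<eta>" and [measurable_cong]: "sets \<eta> = sets (borel \<Otimes>\<^sub>M borel)"
      and m: "distr \<eta> borel fst = P z" "distr \<eta> borel snd = P x"
      and le: "(\<integral>\<^sup>+z. ennreal (dist (fst z) (snd z) powr p) \<partial>\<eta>) \<le> ennreal ((C * dist z x + 1) powr p)"
      by (rule coupled_withinE[OF _ sets_P sets_P])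
    have "(\<integral>\<^sup>+y. ennreal (dist z y powr p) \<partial>P x) = (\<integral>\<^sup>+\<omega>. ennreal (dist z (snd \<omega>) powr p) \<partial>\<eta>)"
      unfolding m[symmetric] by (subst nn_integral_distr) auto
    also have "\<dots> \<le> (\<integral>\<^sup>+\<omega>. ennreal ((dist z (fst \<omega>) + dist (fst \<omega>) (snd \<omega>)) powr p) \<partial>\<eta>)"
      using p by (intro nn_integral_mono ennreal_leI powr_mono2) (auto intro: dist_triangle)
    also have "\<dots> \<le> ennreal ((a + (C * dist z x + 1)) powr p)"
    proof (intro nn_integral_Minkowski p)
      show "(\<integral>\<^sup>+\<omega>. ennreal (dist z (fst \<omega>) powr p) \<partial>\<eta>) \<le> ennreal (a powr p)"
        using a(2) unfolding m[symmetric] by (subst (asm) nn_integral_distr) auto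
    qed (use a(1) C le in \<open>auto intro: add_nonneg_pos\<close>)
    finally show ?thesis by (simp add: add_ac)
  qed
  have "(\<integral>\<^sup>+y. ennreal (dist z y powr p) \<partial>(\<mu> \<bind> P)) = (\<integral>\<^sup>+x. \<integral>\<^sup>+y. ennreal (dist z y powr p) \<partial>P x \<partial>\<mu>)"
    by (rule nn_integral_bind[OF _ P']) measurable
  also have "\<dots> \<le> (\<integral>\<^sup>+x. ennreal ((C * dist z x + (a + 1)) powr p) \<partial>\<mu>)"
    by (intro nn_integral_mono inner)
  also have "\<dots> \<le> ennreal ((C * b + (a + 1)) powr p)"
  proof (intro nn_integral_Minkowski p)
    have "(\<integral>\<^sup>+x. ennreal ((C * dist z x) powr p) \<partial>\<mu>)
        = ennreal (C powr p) * (\<integral>\<^sup>+x. ennreal (dist z x powr p) \<partial>\<mu>)"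
      using C by (subst nn_integral_cmult[symmetric]) (auto simp: powr_mult ennreal_mult)
    also have "\<dots> \<le> ennreal (C powr p) * ennreal (b powr p)" using b(2) by (rule mult_left_mono) simp
    also have "\<dots> = ennreal ((C * b) powr p)" using C b(1) by (simp add: powr_mult flip: ennreal_mult)
    finally show "(\<integral>\<^sup>+x. ennreal ((C * dist z x) powr p) \<partial>\<mu>) \<le> ennreal ((C * b) powr p)" .
  qed (use a(1) b(1) C in \<open>auto simp: emeasure_space_1\<close>)
  also have "\<dots> < \<infinity>" by simp
  finally show ?thesis
    using prob_space_bind'[OF \<mu>_in P] sets_bind'[OF \<mu>_in P] by (auto simp: Pr_def)
qed

text \<open>Two of the three \<epsilon> replace \<open>P\<close> at either end by its average over a
  piece; the third is the defect of the chosen coupling of averages. Mixing along a coupling of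
  \<mu> and \<nu> turns the bound per pair into the integral bound.\<close>

lemma coupled_within_bind_kernel:
  fixes P :: "'a::polish_space \<Rightarrow> 'a measure"
  assumes p: "p \<ge> 1" and C: "C > 0" and P: "P \<in> borel \<rightarrow>\<^sub>M prob_algebra borel"
    and Pr: "\<And>x. P x \<in> Pr p" and lip: "\<And>x y. Wass p (P x) (P y) \<le> ennreal (C * dist x y)"
    and \<mu>: "sets \<mu> = sets borel" "sets \<nu> = sets borel"
    and r: "0 < r" "coupled_within p r \<mu> \<nu>" and \<epsilon>: "\<epsilon> > 0"
  shows "coupled_within p (C * r + 3 * \<epsilon>) (\<mu> \<bind> P) (\<nu> \<bind> P)"
proof -
  obtain \<eta> where \<eta>: "prob_space \<eta>" and [measurable_cong]: "sets \<eta> = sets (borel \<Otimes>\<^sub>M borel)"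
    and m: "distr \<eta> borel fst = \<mu>" "distr \<eta> borel snd = \<nu>"
    and cost: "(\<integral>\<^sup>+z. ennreal (dist (fst z) (snd z) powr p) \<partial>\<eta>) \<le> ennreal (r powr p)"
    using coupled_withinE[OF r(2) \<mu>] .
  interpret \<eta>: prob_space \<eta> by fact
  have fs[measurable]: "fst \<in> \<eta> \<rightarrow>\<^sub>M borel" "snd \<in> \<eta> \<rightarrow>\<^sub>M borel" by measurable
  interpret \<mu>: prob_space \<mu> unfolding m(1)[symmetric] by (rule \<eta>.prob_space_distr) measurable
  interpret \<nu>: prob_space \<nu> unfolding m(2)[symmetric] by (rule \<eta>.prob_space_distr) measurable
  have sets_P: "sets (P x) = sets borel" for x using Pr[of x] by (simp add: Pr_def)
  obtain k :: "'a \<Rightarrow> nat" where k[measurable]: "k \<in> borel \<rightarrow>\<^sub>M count_space UNIV"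
    and k_close: "\<And>M x. prob_space M \<Longrightarrow> sets M = sets borel \<Longrightarrow> AE y in M. k y = k x \<Longrightarrow>
       Wass p (M \<bind> P) (P x) \<le> ennreal \<epsilon>"
    using kernel_partition[OF p P Pr \<epsilon>] by metis
  \<comment> \<open>Closeness holds almost everywhere because on null fibres \<open>cond_on\<close>
    is all of \<open>M\<close>, about which \<open>k_close\<close> says nothing useful.\<close>
  have average: "(\<lambda>i. cond_on M k i \<bind> P) \<in> count_space UNIV \<rightarrow>\<^sub>M prob_algebra borel"
    "M \<bind> (\<lambda>x. cond_on M k (k x) \<bind> P) = M \<bind> P"
    "AE x in M. Wass p (cond_on M k (k x) \<bind> P) (P x) \<le> ennreal \<epsilon>"
    if M: "prob_space M" "sets M = sets borel" for M
  proof -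
    interpret M: prob_space M by fact
    have [measurable_cong]: "sets M = sets borel" by fact
    have PM: "P \<in> M \<rightarrow>\<^sub>M prob_algebra borel" using P by measurable
    have kM: "k \<in> M \<rightarrow>\<^sub>M count_space UNIV" by measurable
    show "(\<lambda>i. cond_on M k i \<bind> P) \<in> count_space UNIV \<rightarrow>\<^sub>M prob_algebra borel"
      using measurable_bind_prob_space[OF M.measurable_cond_on PM] .
    show "M \<bind> (\<lambda>x. cond_on M k (k x) \<bind> P) = M \<bind> P"
      by (rule M.bind_cond_on_kernel[OF kM PM])
    have "prob_space (cond_on M k i)" "sets (cond_on M k i) = sets borel" for i
      using M.cond_on_prob_algebra[of k i] M(2) by (auto simp: space_prob_algebra)
    then show "AE x in M. Wass p (cond_on M k (k x) \<bind> P) (P x) \<le> ennreal \<epsilon>"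
      using M.AE_fibre_not_null[OF kM]
      by (auto elim!: eventually_mono intro!: k_close M.AE_cond_on_eq kM)
  qed
  define Q where "Q i = cond_on \<mu> k i \<bind> P" for i
  define R where "R i = cond_on \<nu> k i \<bind> P" for i
  note Q = average[OF \<mu>.prob_space_axioms \<mu>(1), folded Q_def]
  note R = average[OF \<nu>.prob_space_axioms \<mu>(2), folded R_def]
  have QR: "prob_space (Q i)" "sets (Q i) = sets borel" "prob_space (R i)" "sets (R i) = sets borel" for i
    using measurable_space[OF Q(1), of i] measurable_space[OF R(1), of i] by (auto simp: space_prob_algebra)
  obtain H where H: "\<And>i l. H i l \<in> couplings (Q i) (R l)"
    and H_cost: "\<And>i l w. 0 \<le> w \<Longrightarrow> Wass p (Q i) (R l) \<le> ennreal w \<Longrightarrow>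
      (\<integral>\<^sup>+(x, y). ennreal (dist x y powr p) \<partial>H i l) \<le> ennreal ((w + \<epsilon>) powr p)"
    using ex_nearly_optimal_coupling[OF p QR(1,3) \<epsilon>] by metis
  have H_in: "H i l \<in> space (prob_algebra borel)" for i l
    using H[of i l] by (simp add: couplings_iff[OF QR(2,4)])
  \<comment> \<open>The pair of piece indices takes values in a countable discrete space, so every
    family \<open>H\<close>, however chosen, becomes a measurable kernel after composition.\<close>
  have kk: "(\<lambda>z. (k (fst z), k (snd z))) \<in> \<eta> \<rightarrow>\<^sub>M count_space UNIV"
  proof -
    have "(\<lambda>z. (k (fst z), k (snd z))) \<in> \<eta> \<rightarrow>\<^sub>M count_space UNIV \<Otimes>\<^sub>M count_space UNIV" by measurable
    then show ?thesis by (simp add: pair_measure_countable)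
  qed
  have "coupled_within p (C * r + 3 * \<epsilon>) (\<eta> \<bind> (\<lambda>z. Q (k (fst z)))) (\<eta> \<bind> (\<lambda>z. R (k (snd z))))"
  proof (rule coupled_within_bind[OF \<eta>])
    show "(\<lambda>z. Q (k (fst z))) \<in> \<eta> \<rightarrow>\<^sub>M prob_algebra borel" "(\<lambda>z. R (k (snd z))) \<in> \<eta> \<rightarrow>\<^sub>M prob_algebra borel"
      using Q(1) R(1) by measurable
    have "(\<lambda>(i, l). H i l) \<in> count_space UNIV \<rightarrow>\<^sub>M prob_algebra borel" using H_in by auto
    from measurable_compose[OF kk this]
    show "(\<lambda>z. H (k (fst z)) (k (snd z))) \<in> \<eta> \<rightarrow>\<^sub>M prob_algebra borel" by simp
    have "AE x in distr \<eta> borel fst. Wass p (Q (k x)) (P x) \<le> ennreal \<epsilon>" unfolding m by (rule Q(3))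
    then have "AE z in \<eta>. Wass p (Q (k (fst z))) (P (fst z)) \<le> ennreal \<epsilon>"
      by (rule AE_distrD[rotated]) measurable
    moreover have "AE y in distr \<eta> borel snd. Wass p (R (k y)) (P y) \<le> ennreal \<epsilon>" unfolding m by (rule R(3))
    then have "AE z in \<eta>. Wass p (R (k (snd z))) (P (snd z)) \<le> ennreal \<epsilon>"
      by (rule AE_distrD[rotated]) measurable
    ultimately have "AE z in \<eta>. (\<integral>\<^sup>+(x, y). ennreal (dist x y powr p) \<partial>H (k (fst z)) (k (snd z)))
        \<le> ennreal ((C * dist (fst z) (snd z) + 3 * \<epsilon>) powr p)"
    proof eventually_elim
      case (elim z)
      have "Wass p (Q (k (fst z))) (R (k (snd z))) \<le> Wass p (Q (k (fst z))) (P (fst z))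
          + (Wass p (P (fst z)) (P (snd z)) + Wass p (P (snd z)) (R (k (snd z))))"
        using p by (intro order_trans[OF Wass_triangle add_left_mono[OF Wass_triangle]]) (auto simp: QR sets_P)
      also have "\<dots> \<le> ennreal \<epsilon> + (ennreal (C * dist (fst z) (snd z)) + ennreal \<epsilon>)"
        using elim lip by (intro add_mono) (auto simp: Wass_sym[OF p sets_P QR(4)])
      also have "\<dots> = ennreal (C * dist (fst z) (snd z) + 2 * \<epsilon>)"
        using \<epsilon> C by (simp flip: ennreal_plus)
      finally show ?case
        using H_cost[of "C * dist (fst z) (snd z) + 2 * \<epsilon>"] \<epsilon> C by (simp add: add_ac)
    qed
    then have "(\<integral>\<^sup>+z. (\<integral>\<^sup>+(x, y). ennreal (dist x y powr p) \<partial>H (k (fst z)) (k (snd z))) \<partial>\<eta>)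
        \<le> (\<integral>\<^sup>+z. ennreal ((C * dist (fst z) (snd z) + 3 * \<epsilon>) powr p) \<partial>\<eta>)"
      by (rule nn_integral_mono_AE)
    also have "\<dots> \<le> ennreal ((C * r + 3 * \<epsilon>) powr p)"
    proof (intro nn_integral_Minkowski p)
      have "(\<integral>\<^sup>+z. ennreal ((C * dist (fst z) (snd z)) powr p) \<partial>\<eta>)
          = ennreal (C powr p) * (\<integral>\<^sup>+z. ennreal (dist (fst z) (snd z) powr p) \<partial>\<eta>)"
        using C by (subst nn_integral_cmult[symmetric]) (auto simp: powr_mult ennreal_mult)
      also have "\<dots> \<le> ennreal (C powr p) * ennreal (r powr p)" using cost by (rule mult_left_mono) simp
      also have "\<dots> = ennreal ((C * r) powr p)" using C r(1) by (simp add: powr_mult flip: ennreal_mult)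
      finally show "(\<integral>\<^sup>+z. ennreal ((C * dist (fst z) (snd z)) powr p) \<partial>\<eta>) \<le> ennreal ((C * r) powr p)" .
    qed (use r(1) \<epsilon> C in \<open>auto simp: \<eta>.emeasure_space_1\<close>)
    finally show "(\<integral>\<^sup>+z. (\<integral>\<^sup>+(x, y). ennreal (dist x y powr p) \<partial>H (k (fst z)) (k (snd z))) \<partial>\<eta>)
        \<le> ennreal ((C * r + 3 * \<epsilon>) powr p)" .
  qed (rule H)
  moreover have "\<eta> \<bind> (\<lambda>z. Q (k (fst z))) = \<mu> \<bind> P"
    using bind_distr[OF fs(1) measurable_prob_algebraD[OF measurable_compose[OF k Q(1)]] \<eta>.not_empty]
    by (simp add: m Q(2))
  moreover have "\<eta> \<bind> (\<lambda>z. R (k (snd z))) = \<nu> \<bind> P"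
    using bind_distr[OF fs(2) measurable_prob_algebraD[OF measurable_compose[OF k R(1)]] \<eta>.not_empty]
    by (simp add: m R(2))
  ultimately show ?thesis by simp
qed

theorem theorem3:
  fixes P :: "'a::{polish_space, length_space} \<Rightarrow> 'a measure" and p C :: real
  assumes "p \<ge> 1" and "C > 0"
    and "P \<in> borel \<rightarrow>\<^sub>M prob_algebra borel"
    and "\<And>x. P x \<in> Pr p"
    and "locally_lipschitz C (Wass p) P"
  shows "(\<forall>\<mu>\<in>Pr p. \<mu> \<bind> P \<in> Pr p) \<and>
         (\<forall>\<mu>\<in>Pr p. \<forall>\<nu>\<in>Pr p. Wass p (\<mu> \<bind> P) (\<nu> \<bind> P) \<le> ennreal C * Wass p \<mu> \<nu>)"
proof -
  have P: "prob_space (P x)" "sets (P x) = sets borel" for x using assms(4)[of x] by (auto simp: Pr_def)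
  have lip: "Wass p (P x) (P y) \<le> ennreal (C * dist x y)" for x y
    using assms(1,2)
    by (intro lipschitz_of_locally_lipschitz[OF assms(5)] Wass_self Wass_sym Wass_triangle P) auto
  have "Wass p (\<mu> \<bind> P) (\<nu> \<bind> P) \<le> ennreal C * Wass p \<mu> \<nu>" if \<mu>: "\<mu> \<in> Pr p" "\<nu> \<in> Pr p" for \<mu> \<nu>
  proof (cases "Wass p \<mu> \<nu> = \<infinity>")
    case True
    then show ?thesis using assms(2) by (simp add: ennreal_mult_top)
  next
    case False
    then obtain w where w: "Wass p \<mu> \<nu> = ennreal w" "0 \<le> w"
      by (metis ennreal_cases infinity_ennreal_def)
    have "Wass p (\<mu> \<bind> P) (\<nu> \<bind> P) \<le> ennreal (C * w) + ennreal e" if e: "e > 0" for e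
    proof -
      \<comment> \<open>The kernel multiplies the slack \<open>e / (2 * C)\<close> by C, giving half
        of \<open>e\<close>; the other half is three times \<open>e / 6\<close>. The slack also
        makes the radius positive when \<open>w = 0\<close>.\<close>
      have "coupled_within p (w + e / (2 * C)) \<mu> \<nu>"
        using assms(1,2) w e by (intro coupled_within_of_Wass_less) (auto simp: ennreal_less_iff add_nonneg_pos)
      then have "coupled_within p (C * (w + e / (2 * C)) + 3 * (e / 6)) (\<mu> \<bind> P) (\<nu> \<bind> P)"
        using \<mu> assms(2) w e
        by (intro coupled_within_bind_kernel[OF assms(1,2,3,4) lip]) (auto simp: Pr_def add_nonneg_pos)
      also have "C * (w + e / (2 * C)) + 3 * (e / 6) = C * w + e" using assms(2) by (simp add: field_simps)
      finally have "Wass p (\<mu> \<bind> P) (\<nu> \<bind> P) \<le> ennreal (C * w + e)"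
        using assms(1,2) w e by (intro Wass_le_of_coupled_within) auto
      then show ?thesis using assms(2) w e by simp
    qed
    then have "Wass p (\<mu> \<bind> P) (\<nu> \<bind> P) \<le> ennreal (C * w)" by (rule ennreal_le_epsilon)
    then show ?thesis using assms(2) w by (simp add: ennreal_mult)
  qed
  then show ?thesis using bind_in_Pr[OF assms(1-4) lip] by blast
qed

end
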